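(* Let $1\le p\le\infty$, let $\mathcal R:(f,T)\mapsto e$ be an arbitrary refinement rule and let $f\in L^p(\Omega)$. With $V(f,\mathcal R)_p$, the greedy tree approximations $f_N$, the optimal tree approximations $f_N^*$ and the wavelet thresholding approximations $f_\varepsilon$ as defined in the context, the following statements are equivalent: (i) $f\in V(f,\mathcal R)_p$. (ii) The greedy tree approximation converges: $\lim_{N\to+\infty}\|f-f_N\|_{L^p(\Omega)}=0$. (iii) The optimal tree approximation converges: $\lim_{N\to+\infty}\|f-f_N^*\|_{L^p(\Omega)}=0$. In the case $p=2$, they are also equivalent to: (iv) The thresholding approximation converges: $\lim_{\varepsilon\to0}\|f-f_\varepsilon\|_{L^2(\Omega)}=0$.
   Context: **Setting.** $\Omega\subset\mathbb R^2$ is a compact polygonal domain (such as $[0,1]^2$) and $\mathcal D_0$ is a fixed finite triangulation of $\Omega$ (finitely many non-degenerate closed triangles with union $\Omega$ and pairwise disjoint interiors), independent of $f$; $N_0:=\#(\mathcal D_0)$. Fix an integer $m\ge0$ and $1\le p\le\infty$. $\Pi_m$ is the space of real bivariate polynomials of total degree at most $m$, and $\Pi_m(T)$ denotes its restriction to $T$ (extended by $0$ outside $T$). **Local approximation.** For each triangle $T$, $\mathcal A_T$ is a linear operator from $L^p(T)$ onto $\Pi_m$ satisfying $$\|f-\mathcal A_Tf\|_{L^p(T)}\le C\inf_{\pi\in\Pi_m}\|f-\pi\|_{L^p(T)}$$ with a constant $C$ independent of $f$ and $T$. Examples: the $L^2(T)$-orthogonal projection $P_T$ onto $\Pi_m$;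 or, for $p=\infty$, the Lagrange interpolation operator $I_T$ at the points $\sum_i\frac{k_i}{m}v_i$, $k_i\in\mathbb N$ (nonnegative integers), $\sum_i k_i=m$, where $v_1,v_2,v_3$ are the vertices of $T$ (at the barycenter if $m=0$). The operator $I_T$ is defined only on continuous functions, so when it is used, $f$ is understood to be continuous. The local error is $e_T(f)_p:=\|f-\mathcal A_Tf\|_{L^p(T)}$. **Refinement rule and hierarchy.** A refinement rule $\mathcal R$ assigns to $f$ and to each triangle $T$ one of the three edges $e$ of $T$. Bisecting $T$ according to $e$ means splitting $T$ into two triangles of equal area by the segment joining the vertex opposite to $e$ to the midpoint of $e$; the two resulting triangles form the set $\mathcal C(T)$ of children of $T$. Inductively, $\mathcal D_j:=\bigcup_{T\in\mathcal D_{j-1}}\mathcal C(T)$ for $j\ge1$, and $\mathcal D:=\bigcup_{j\ge0}\mathcal D_j$, which has a binary tree (forest) structure with roots the elements of $\mathcal D_0$. These depend on $f$ and $\mathcal R$. Triangulations may be non-conforming. **Multiresolution spaces.** $V_j(f,\mathcal R):=\{g:\ g|_T\in\Pi_m \text{ for all } T\in\mathcal D_j\}$, $V(f,\mathcal R):=\bigcup_{j\ge0}V_j(f,\mathcal R)$, and $V(f,\mathcal R)_p$ is the closure of $V(f,\mathcal R)$ in $L^p(\Omega)$. **Greedy tree approximation.** Set $\mathcal T_{N_0}:=\mathcal D_0$. For $N>N_0$, $\mathcal T_N$ is obtained from $\mathcal T_{N-1}$ by replacing a triangle $T^*_{N-1}\in\mathcal T_{N-1}$ which maximizes $e_T(f)_p$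 over $T\in\mathcal T_{N-1}$ by its two children. Then $f_N$ is the piecewise polynomial function equal to $\mathcal A_Tf$ on each $T\in\mathcal T_N$. **Optimal tree approximation.** For $N\ge N_0$, $\mathcal T_N^*$ is a partition of $\Omega$ by elements of $\mathcal D$, of cardinality at most $N$, which minimizes $\sum_{T\in\mathcal T}e_T(f)_p^p$ (respectively $\max_{T\in\mathcal T}e_T(f)_\infty$ if $p=\infty$) among all partitions $\mathcal T$ of $\Omega$ by elements of $\mathcal D$ with $\#(\mathcal T)\le N$ (triangles in a partition have pairwise disjoint interiors). Then $f_N^*$ is equal to $\mathcal A_Tf$ on each $T\in\mathcal T_N^*$. **Wavelets and thresholding (case $p=2$).** For each $T\in\mathcal D_0$ let $(\varphi_T^i)_{1\le i\le\frac12(m+1)(m+2)}$ be an $L^2(T)$-orthonormal basis of $\Pi_m(T)$. For each $T\in\mathcal D$ with children $T',T''$ let $(\psi_T^i)_{1\le i\le\frac12(m+1)(m+2)}$ be an $L^2$-orthonormal basis of the orthogonal complement of $\Pi_m(T)$ in $\Pi_m(T')\oplus\Pi_m(T'')$. The family of all $\varphi_T^i$ ($T\in\mathcal D_0$) and all $\psi_T^i$ ($T\in\mathcal D_j$, $j\ge0$) is an orthonormal basis of $V(f,\mathcal R)_2$, denoted $(\psi_\lambda)_{\lambda\in\Lambda}$. With $f_\lambda:=\langle f,\psi_\lambda\rangle_{L^2(\Omega)}$, for $\varepsilon>0$, $$f_\varepsilon:=\sum_{\lambda:\ |f_\lambda|\ge\varepsilon}f_\lambda\psi_\lambda .$$ 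*)

theory Defs
  imports "HOL-Analysis.Analysis" "HOL-Probability.Essential_Supremum"
begin

type_synonym plane_fun = "real^2 \<Rightarrow> real"
type_synonym triangle = "(real^2) set"

text \<open>
  Elements of \<open>L\<^sup>p(S)\<close> are represented by functions on the whole plane, of which only the values
  almost everywhere on \<open>S\<close> matter; equality in \<open>L\<^sup>p(S)\<close> is always written out as equality
  almost everywhere.
\<close>

definition Lp :: "ereal \<Rightarrow> (real^2) set \<Rightarrow> plane_fun set" where
  "Lp p S = {f \<in> borel_measurable (lebesgue_on S).
     if p = \<infinity> then esssup (lebesgue_on S) (\<lambda>x. ereal \<bar>f x\<bar>) < \<infinity>
     else integrable (lebesgue_on S) (\<lambda>x. \<bar>f x\<bar> powr real_of_ereal p)}"

definition Lp_norm :: "ereal \<Rightarrow> (real^2) set \<Rightarrow> plane_fun \<Rightarrow> real" where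
  "Lp_norm p S f =
     (if p = \<infinity> then real_of_ereal (esssup (lebesgue_on S) (\<lambda>x. ereal \<bar>f x\<bar>))
      else (LINT x|lebesgue_on S. \<bar>f x\<bar> powr real_of_ereal p) powr (1 / real_of_ereal p))"

definition L2_inner :: "(real^2) set \<Rightarrow> plane_fun \<Rightarrow> plane_fun \<Rightarrow> real" where
  "L2_inner S f g = (LINT x|lebesgue_on S. f x * g x)"

definition Poly :: "nat \<Rightarrow> plane_fun set" where
  "Poly m = {\<pi>. \<exists>c. \<forall>x. \<pi> x = (\<Sum>i\<le>m. \<Sum>j\<le>m - i. c i j * (x $ 1) ^ i * (x $ 2) ^ j)}"

text \<open>
  \<open>X S\<close> is the class of functions on \<open>S\<close> on which the operators \<open>A T\<close> act: \<open>L\<^sup>p(S)\<close>, or also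
  \<open>C(S)\<close> if \<open>p = \<infinity>\<close>. The latter is needed for operators, like Lagrange interpolation, that are
  defined on continuous functions only.
\<close>

definition function_class :: "ereal \<Rightarrow> ((real^2) set \<Rightarrow> plane_fun set) \<Rightarrow> bool" where
  "function_class p X \<longleftrightarrow> X = Lp p \<or> (p = \<infinity> \<and> X = (\<lambda>S. {g. continuous_on S g}))"

text \<open>
  The clause on almost everywhere equal functions says that \<open>A T\<close> is a well-defined operator on
  (classes of) functions on \<open>T\<close>; triangles are the nondegenerate closed ones, as \<open>2 simplex T\<close>.
\<close>

definition local_approximation ::
    "ereal \<Rightarrow> nat \<Rightarrow> ((real^2) set \<Rightarrow> plane_fun set) \<Rightarrow> (triangle \<Rightarrow> plane_fun \<Rightarrow> plane_fun) \<Rightarrow> bool"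
  where
  "local_approximation p m X A \<longleftrightarrow>
     (\<forall>T. 2 simplex T \<longrightarrow>
        (\<forall>g\<in>X T. \<forall>h\<in>X T. (AE x in lebesgue_on T. g x = h x) \<longrightarrow> A T g = A T h) \<and>
        (\<forall>g\<in>X T. \<forall>h\<in>X T. \<forall>a b.
           A T (\<lambda>x. a * g x + b * h x) = (\<lambda>x. a * A T g x + b * A T h x)) \<and>
        A T ` X T = Poly m) \<and>
     (\<exists>C. \<forall>T. 2 simplex T \<longrightarrow>
        (\<forall>g\<in>X T. Lp_norm p T (\<lambda>x. g x - A T g x)
                  \<le> C * (INF \<pi>\<in>Poly m. Lp_norm p T (\<lambda>x. g x - \<pi> x))))"

definition local_error ::
    "ereal \<Rightarrow> (triangle \<Rightarrow> plane_fun \<Rightarrow> plane_fun) \<Rightarrow> plane_fun \<Rightarrow> triangle \<Rightarrow> real" where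
  "local_error p A f T = Lp_norm p T (\<lambda>x. f x - A T f x)"

text \<open>
  The piecewise polynomial function equal to \<open>A T f\<close> on each \<open>T \<in> \<T>\<close>. It is set to \<open>0\<close> on the
  edges, a null set where neighbouring polynomials may disagree.
\<close>

definition piecewise_approx ::
    "(triangle \<Rightarrow> plane_fun \<Rightarrow> plane_fun) \<Rightarrow> plane_fun \<Rightarrow> triangle set \<Rightarrow> plane_fun" where
  "piecewise_approx A f \<T> = (\<lambda>x. \<Sum>T\<in>\<T>. indicat_real (interior T) x * A T f x)"

definition triangle_partition :: "(real^2) set \<Rightarrow> triangle set \<Rightarrow> bool" where
  "triangle_partition \<Omega> \<T> \<longleftrightarrow>
     finite \<T> \<and> (\<forall>T\<in>\<T>. 2 simplex T) \<and> \<Union>\<T> = \<Omega> \<and>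
     pairwise (\<lambda>S T. interior S \<inter> interior T = {}) \<T>"

definition refinement_rule :: "(plane_fun \<Rightarrow> triangle \<Rightarrow> (real^2) set) \<Rightarrow> bool" where
  "refinement_rule R \<longleftrightarrow> (\<forall>f T. 2 simplex T \<longrightarrow> R f T edge_of T)"

text \<open>
  If \<open>e\<close> is the edge \<open>ab\<close> of \<open>T = abc\<close>, this set consists of exactly two triangles, obtained from
  the two orderings of the end points \<open>a\<close> and \<open>b\<close> of \<open>e\<close>.
\<close>

definition bisect :: "triangle \<Rightarrow> (real^2) set \<Rightarrow> triangle set" where
  "bisect T e = {convex hull {a, midpoint a b, c} |a b c.
                   T = convex hull {a, b, c} \<and> e = closed_segment a b}"

primrec hierarchy ::
    "(plane_fun \<Rightarrow> triangle \<Rightarrow> (real^2) set) \<Rightarrow> plane_fun \<Rightarrow> triangle set \<Rightarrow> nat \<Rightarrow> triangle set" where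
  "hierarchy R f D0 0 = D0"
| "hierarchy R f D0 (Suc j) = (\<Union>T\<in>hierarchy R f D0 j. bisect T (R f T))"

definition V_level :: "nat \<Rightarrow> triangle set \<Rightarrow> plane_fun set" where
  "V_level m \<T> = {g. \<forall>T\<in>\<T>. \<exists>\<pi>\<in>Poly m. AE x in lebesgue_on T. g x = \<pi> x}"

definition V_space ::
    "nat \<Rightarrow> (plane_fun \<Rightarrow> triangle \<Rightarrow> (real^2) set) \<Rightarrow> plane_fun \<Rightarrow> triangle set \<Rightarrow> plane_fun set" where
  "V_space m R f D0 = (\<Union>j. V_level m (hierarchy R f D0 j))"

definition Lp_closure :: "ereal \<Rightarrow> (real^2) set \<Rightarrow> plane_fun set \<Rightarrow> plane_fun set" where
  "Lp_closure p \<Omega> V = {h \<in> Lp p \<Omega>. \<forall>\<epsilon>>0. \<exists>g\<in>V. Lp_norm p \<Omega> (\<lambda>x. h x - g x) < \<epsilon>}"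

text \<open>
  Neither the greedy nor the optimal partitions are unique, because of ties; the following
  predicates hold for all admissible choices.
\<close>

definition greedy_partitions ::
    "ereal \<Rightarrow> (triangle \<Rightarrow> plane_fun \<Rightarrow> plane_fun) \<Rightarrow> (plane_fun \<Rightarrow> triangle \<Rightarrow> (real^2) set) \<Rightarrow>
     plane_fun \<Rightarrow> triangle set \<Rightarrow> (nat \<Rightarrow> triangle set) \<Rightarrow> bool" where
  "greedy_partitions p A R f D0 \<T> \<longleftrightarrow>
     \<T> (card D0) = D0 \<and>
     (\<forall>N>card D0. \<exists>T. is_arg_max (local_error p A f) (\<lambda>T. T \<in> \<T> (N - 1)) T \<and>
                       \<T> N = (\<T> (N - 1) - {T}) \<union> bisect T (R f T))"

definition tree_partition ::
    "(real^2) set \<Rightarrow> (plane_fun \<Rightarrow> triangle \<Rightarrow> (real^2) set) \<Rightarrow> plane_fun \<Rightarrow> triangle set \<Rightarrow>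
     nat \<Rightarrow> triangle set \<Rightarrow> bool" where
  "tree_partition \<Omega> R f D0 N \<T> \<longleftrightarrow>
     triangle_partition \<Omega> \<T> \<and> \<T> \<subseteq> (\<Union>j. hierarchy R f D0 j) \<and> card \<T> \<le> N"

definition tree_cost ::
    "ereal \<Rightarrow> (triangle \<Rightarrow> plane_fun \<Rightarrow> plane_fun) \<Rightarrow> plane_fun \<Rightarrow> triangle set \<Rightarrow> real" where
  "tree_cost p A f \<T> =
     (if p = \<infinity> then Max (local_error p A f ` \<T>)
      else \<Sum>T\<in>\<T>. local_error p A f T powr real_of_ereal p)"

definition optimal_partitions ::
    "ereal \<Rightarrow> (real^2) set \<Rightarrow> (triangle \<Rightarrow> plane_fun \<Rightarrow> plane_fun) \<Rightarrow>
     (plane_fun \<Rightarrow> triangle \<Rightarrow> (real^2) set) \<Rightarrow> plane_fun \<Rightarrow> triangle set \<Rightarrow>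
     (nat \<Rightarrow> triangle set) \<Rightarrow> bool" where
  "optimal_partitions p \<Omega> A R f D0 \<T> \<longleftrightarrow>
     (\<forall>N\<ge>card D0. is_arg_min (tree_cost p A f) (tree_partition \<Omega> R f D0 N) (\<T> N))"

definition Poly_on :: "nat \<Rightarrow> triangle \<Rightarrow> plane_fun set" where
  "Poly_on m T = {g. \<exists>\<pi>\<in>Poly m. AE x in lebesgue. g x = indicat_real T x * \<pi> x}"

definition Poly_sum :: "nat \<Rightarrow> triangle set \<Rightarrow> plane_fun set" where
  "Poly_sum m \<C> = {\<lambda>x. \<Sum>T\<in>\<C>. h T x |h. \<forall>T\<in>\<C>. h T \<in> Poly_on m T}"

definition orthonormal_basis ::
    "triangle \<Rightarrow> plane_fun set \<Rightarrow> nat \<Rightarrow> (nat \<Rightarrow> plane_fun) \<Rightarrow> bool" where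
  "orthonormal_basis T W n b \<longleftrightarrow>
     (\<forall>i\<in>{1..n}. b i \<in> W) \<and>
     (\<forall>i\<in>{1..n}. \<forall>j\<in>{1..n}. L2_inner T (b i) (b j) = (if i = j then 1 else 0)) \<and>
     (\<forall>g\<in>W. \<exists>c. AE x in lebesgue. g x = (\<Sum>i=1..n. c i * b i x))"

definition num_basis :: "nat \<Rightarrow> nat" where
  "num_basis m = (m + 1) * (m + 2) div 2"

definition wavelet_system ::
    "nat \<Rightarrow> (plane_fun \<Rightarrow> triangle \<Rightarrow> (real^2) set) \<Rightarrow> plane_fun \<Rightarrow> triangle set \<Rightarrow>
     (triangle \<Rightarrow> nat \<Rightarrow> plane_fun) \<Rightarrow> (triangle \<Rightarrow> nat \<Rightarrow> plane_fun) \<Rightarrow> bool" where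
  "wavelet_system m R f D0 \<phi> \<psi> \<longleftrightarrow>
     (\<forall>T\<in>D0. orthonormal_basis T (Poly_on m T) (num_basis m) (\<phi> T)) \<and>
     (\<forall>T\<in>(\<Union>j. hierarchy R f D0 j).
        orthonormal_basis T
          {g \<in> Poly_sum m (bisect T (R f T)). \<forall>h\<in>Poly_on m T. L2_inner T g h = 0}
          (num_basis m) (\<psi> T))"

text \<open>
  Index set \<open>\<Lambda>\<close> of the family of all \<open>\<phi> T i\<close> (left summand) and all \<open>\<psi> T i\<close> (right summand).
\<close>

definition wavelet_index ::
    "nat \<Rightarrow> (plane_fun \<Rightarrow> triangle \<Rightarrow> (real^2) set) \<Rightarrow> plane_fun \<Rightarrow> triangle set \<Rightarrow>
     (triangle \<times> nat + triangle \<times> nat) set" where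
  "wavelet_index m R f D0 =
     (D0 \<times> {1..num_basis m}) <+> ((\<Union>j. hierarchy R f D0 j) \<times> {1..num_basis m})"

definition wavelet ::
    "(triangle \<Rightarrow> nat \<Rightarrow> plane_fun) \<Rightarrow> (triangle \<Rightarrow> nat \<Rightarrow> plane_fun) \<Rightarrow>
     triangle \<times> nat + triangle \<times> nat \<Rightarrow> plane_fun" where
  "wavelet \<phi> \<psi> l = (case l of Inl (T, i) \<Rightarrow> \<phi> T i | Inr (T, i) \<Rightarrow> \<psi> T i)"

text \<open>
  For \<open>f \<in> L\<^sup>2(\<Omega>)\<close>, an orthonormal family and \<open>\<epsilon> > 0\<close>, the sum below is finite by Bessel's
  inequality.
\<close>

definition threshold_approx ::
    "nat \<Rightarrow> (real^2) set \<Rightarrow> (plane_fun \<Rightarrow> triangle \<Rightarrow> (real^2) set) \<Rightarrow> plane_fun \<Rightarrow> triangle set \<Rightarrow>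
     (triangle \<Rightarrow> nat \<Rightarrow> plane_fun) \<Rightarrow> (triangle \<Rightarrow> nat \<Rightarrow> plane_fun) \<Rightarrow> real \<Rightarrow> plane_fun" where
  "threshold_approx m \<Omega> R f D0 \<phi> \<psi> \<epsilon> = (\<lambda>x.
     \<Sum>l\<in>{l \<in> wavelet_index m R f D0. \<bar>L2_inner \<Omega> f (wavelet \<phi> \<psi> l)\<bar> \<ge> \<epsilon>}.
       L2_inner \<Omega> f (wavelet \<phi> \<psi> l) * wavelet \<phi> \<psi> l x)"

end

theory Submission
  imports Defs
begin

text \<open>
  Near-best local approximation is what connects the three partitions with the closure of the
  piecewise polynomials. Suppose that \<open>f\<close> is within \<open>\<epsilon>\<close> of a function \<open>g\<close> that is piecewise
  polynomial on the triangles of level \<open>J\<close>. Any triangle \<open>T\<close> of level at least \<open>J\<close> lies in one of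
  those, so \<open>g\<close> is a polynomial on \<open>T\<close> and the local error is at most \<open>C\<close> times the norm of
  \<open>f - g\<close> on \<open>T\<close>. For \<open>p < \<infinity>\<close> the \<open>p\<close>-th powers of these norms add up over disjoint triangles,
  hence in every partition the triangles of level at least \<open>J\<close> together contribute at most
  \<open>(C \<epsilon>)\<^sup>p\<close>; for \<open>p = \<infinity>\<close> each of them has error at most \<open>C \<epsilon>\<close>. Only finitely many triangles have
  a smaller level, and they contribute little as soon as their local errors are small
  (\<open>tree_cost_small\<close>).

  The partition into all triangles of level \<open>J\<close> is of this kind, and optimal partitions do at least
  as well once they are allowed as many triangles. For the greedy partitions, the same estimate
  shows that only finitely many triangles of the hierarchy have a local error above a given
  \<open>\<delta>\<close>. A triangle that has been split never returns, so that from some step on the triangle chosen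
  for splitting has error at most \<open>\<delta>\<close>; as it maximizes the error, so has every triangle of the
  current partition (\<open>greedy_error_eventually_small\<close>). Conversely, a finite partition by triangles
  of the hierarchy is coarser than some level (\<open>tree_partition_coarser_than_level\<close>), so tree
  approximations are piecewise polynomial on that level and their convergence puts \<open>f\<close> into the
  closure.

  For \<open>p = 2\<close>, subtracting from a piecewise polynomial on level \<open>j + 1\<close> its orthogonal projections
  onto the polynomials on the triangles of level \<open>j\<close> leaves a combination of wavelets. By
  induction the wavelets span all piecewise polynomials (\<open>V_level_span\<close>), and they are
  orthonormal (\<open>wavelet_orthonormal\<close>). Now let a finite combination of wavelets be close to \<open>f\<close>.
  For small \<open>\<epsilon>\<close> the thresholded expansion contains every wavelet of this combination
  whose coefficient with respect to \<open>f\<close> is not zero, so it is the orthogonal projection of \<open>f\<close>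
  onto a space containing the combination, and is at least as close (\<open>threshold_tendsto\<close>).
  Conversely, thresholded expansions are finite sums by Bessel's inequality, and their terms are
  piecewise polynomials on some level.
\<close>

section \<open>Bisecting a triangle\<close>

lemma interior_triangle_nonempty: "2 simplex T \<Longrightarrow> interior (T :: triangle) \<noteq> {}"
  using aff_dim_simplex[of 2 T] interior_rel_interior_gen[of T] convex_simplex[of 2 T]
    rel_interior_eq_empty[of T] aff_dim_empty[of T]
  by auto

text \<open>
  Faces of a simplex are spanned by subsets of its vertices, and the dimension of an edge leaves
  room for exactly two of the three.
\<close>

lemma edge_vertices:
  fixes T e :: triangle
  assumes "2 simplex T" "e edge_of T"
  obtains a b c where "a \<noteq> b" "a \<noteq> c" "b \<noteq> c" "\<not> affine_dependent {a, b, c}"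
    "T = convex hull {a, b, c}" "e = closed_segment a b"
proof -
  obtain V where V: "\<not> affine_dependent V" "int (card V) = 2 + 1" "T = convex hull V"
    using assms(1) by (auto simp: simplex_def)
  have "e face_of convex hull V" "aff_dim e = 1"
    using assms(2) V by (auto simp: edge_of_def)
  then obtain W where W: "W \<subseteq> V" "e = convex hull W"
    using face_of_convex_hull_affine_independent[OF V(1)] by auto
  have "\<not> affine_dependent W"
    using V(1) W(1) affine_independent_subset by blast
  then have "aff_dim e = int (card W) - 1"
    using W(2) by (simp add: aff_dim_convex_hull affine_independent_iff_card)
  with \<open>aff_dim e = 1\<close> have "card W = 2" by simp
  then obtain a b where ab: "W = {a, b}" "a \<noteq> b" by (auto simp: card_2_iff)
  have finV: "finite V" using V(1) aff_independent_finite by blast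
  have "card (V - W) = 1"
    using V(2) \<open>card W = 2\<close> W(1) finV by (simp add: card_Diff_subset finite_subset)
  then obtain c where "V - W = {c}" using card_1_singletonE by blast
  with W(1) ab have "V = {a, b, c}" "a \<noteq> c" "b \<noteq> c" by auto
  with that ab V W show ?thesis by (metis segment_convex_hull)
qed

text \<open>
  The vertices of a triangle are its extreme points, and the end points of an edge are determined
  by the edge. Hence all labellings admitted in the definition of the bisection agree with
  \<open>a\<close>, \<open>b\<close>, \<open>c\<close> up to exchanging \<open>a\<close> and \<open>b\<close>.
\<close>

lemma bisect_eq:
  fixes a b c :: "real^2"
  assumes ind: "\<not> affine_dependent {a, b, c}" and "a \<noteq> b" "a \<noteq> c" "b \<noteq> c"
  shows "bisect (convex hull {a, b, c}) (closed_segment a b) =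
    {convex hull {a, midpoint a b, c}, convex hull {b, midpoint a b, c}}"
proof
  show "{convex hull {a, midpoint a b, c}, convex hull {b, midpoint a b, c}}
    \<subseteq> bisect (convex hull {a, b, c}) (closed_segment a b)"
  proof -
    have "convex hull {b, midpoint a b, c} = convex hull {b, midpoint b a, c}"
      "convex hull {a, b, c} = convex hull {b, a, c}"
      by (simp_all only: midpoint_sym insert_commute[of a b])
    then show ?thesis
      unfolding bisect_def using closed_segment_commute[of a b] by blast
  qed
  show "bisect (convex hull {a, b, c}) (closed_segment a b)
    \<subseteq> {convex hull {a, midpoint a b, c}, convex hull {b, midpoint a b, c}}"
  proof
    fix S assume "S \<in> bisect (convex hull {a, b, c}) (closed_segment a b)"
    then obtain a' b' c' where S: "S = convex hull {a', midpoint a' b', c'}"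
      and T: "convex hull {a, b, c} = convex hull {a', b', c'}"
      and e: "closed_segment a b = closed_segment a' b'"
      unfolding bisect_def by auto
    have ab: "{a, b} = {a', b'}" using e by simp
    have "{x. x extreme_point_of convex hull {a, b, c}} = {a, b, c}"
      using extreme_point_of_convex_hull_affine_independent[OF ind] by auto
    moreover have "{x. x extreme_point_of convex hull {a', b', c'}} \<subseteq> {a', b', c'}"
      using extreme_point_of_convex_hull by blast
    ultimately have "{a, b, c} \<subseteq> {a', b', c'}" using T by simp
    with ab assms have "c' = c" by auto
    with ab S show "S \<in> {convex hull {a, midpoint a b, c}, convex hull {b, midpoint a b, c}}"
      by (auto simp: doubleton_eq_iff midpoint_sym)
  qed
qed

text \<open>
  The half is nondegenerate because its affine hull still contains \<open>b\<close>, the reflection of \<open>a\<close> in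
  the midpoint.
\<close>

lemma half_triangle_simplex:
  fixes a b c :: "real^2"
  assumes "\<not> affine_dependent {a, b, c}" "a \<noteq> b" "a \<noteq> c" "b \<noteq> c"
  shows "2 simplex (convex hull {a, midpoint a b, c})"
proof -
  let ?m = "midpoint a b"
  have "b = 2 *\<^sub>R ?m + (-1) *\<^sub>R a"
    by (simp add: midpoint_def)
  moreover have "2 *\<^sub>R ?m + (-1) *\<^sub>R a \<in> affine hull {a, ?m, c}"
    by (rule mem_affine) (auto simp: hull_inc)
  ultimately have "b \<in> affine hull {a, ?m, c}" by simp
  then have "affine hull {a, b, c} \<subseteq> affine hull {a, ?m, c}"
    by (intro hull_minimal) (auto simp: hull_inc)
  then have "aff_dim {a, b, c} \<le> aff_dim {a, ?m, c}"
    by (metis aff_dim_affine_hull aff_dim_subset)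
  moreover have "aff_dim {a, b, c} = 2"
    using assms by (simp add: affine_independent_iff_card)
  moreover have "aff_dim {a, ?m, c} \<le> int (card {a, ?m, c}) - 1"
    by (rule aff_dim_le_card) simp
  moreover have "card {a, ?m, c} \<le> 3"
    by (simp add: card_insert_if)
  ultimately have "aff_dim {a, ?m, c} = int (card {a, ?m, c}) - 1" "card {a, ?m, c} = 3"
    by linarith+
  then show ?thesis
    by (intro simplex_convex_hull) (auto simp: affine_independent_iff_card)
qed

lemma half_triangle_subset:
  "convex hull {a, midpoint a b, c} \<subseteq> convex hull {a, b, c}" for a b c :: "real^2"
proof (rule hull_minimal)
  have "closed_segment a b \<subseteq> convex hull {a, b, c}"
    unfolding segment_convex_hull by (rule hull_mono) auto
  then show "{a, midpoint a b, c} \<subseteq> convex hull {a, b, c}"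
    using midpoint_in_closed_segment[of a b] by (auto simp: hull_inc)
qed auto

text \<open>
  In barycentric coordinates \<open>u\<close>, \<open>v\<close>, \<open>w\<close>, the half at the vertex \<open>a\<close> is described by \<open>v \<le> u\<close>.
\<close>

lemma triangle_subset_halves:
  fixes a b c :: "real^2"
  shows "convex hull {a, b, c} \<subseteq> convex hull {a, midpoint a b, c} \<union> convex hull {b, midpoint a b, c}"
proof
  have half: "u *\<^sub>R a + v *\<^sub>R b + w *\<^sub>R c \<in> convex hull {a, midpoint a b, c}"
    if "0 \<le> v" "v \<le> u" "0 \<le> w" "u + v + w = 1" for u v w and a b c :: "real^2"
  proof -
    have "u *\<^sub>R a + v *\<^sub>R b + w *\<^sub>R c = (u - v) *\<^sub>R a + (2 * v) *\<^sub>R midpoint a b + w *\<^sub>R c"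
      by (simp add: midpoint_def algebra_simps)
    moreover have "0 \<le> u - v" "0 \<le> 2 * v" "(u - v) + 2 * v + w = 1" using that by auto
    ultimately show ?thesis using that(3) unfolding convex_hull_3 by blast
  qed
  fix x assume "x \<in> convex hull {a, b, c}"
  then obtain u v w where uvw: "0 \<le> u" "0 \<le> v" "0 \<le> w" "u + v + w = 1"
    and x: "x = u *\<^sub>R a + v *\<^sub>R b + w *\<^sub>R c"
    unfolding convex_hull_3 by blast
  show "x \<in> convex hull {a, midpoint a b, c} \<union> convex hull {b, midpoint a b, c}"
  proof (cases "v \<le> u")
    case True
    then show ?thesis using half[of v u w a b c] uvw x by auto
  next
    case False
    have "x = v *\<^sub>R b + u *\<^sub>R a + w *\<^sub>R c" using x by (simp add: add.commute)
    with False show ?thesis using half[of u v w b a c] uvw by (auto simp: midpoint_sym)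
  qed
qed

text \<open>
  The line through \<open>c\<close> and the midpoint separates the halves: it passes through the midpoint of
  \<open>a\<close> and \<open>b\<close>, so these cannot lie strictly on the same side.
\<close>

lemma halves_interiors_disjoint:
  fixes a b c :: "real^2"
  assumes "midpoint a b \<noteq> c"
  shows "interior (convex hull {a, midpoint a b, c}) \<inter> interior (convex hull {b, midpoint a b, c}) = {}"
proof -
  let ?m = "midpoint a b"
  \<comment> \<open>A normal vector of the separating line.\<close>
  define n :: "real^2" where "n = vector [- ((c - ?m) $ 2), (c - ?m) $ 1]"
  have n0: "n \<noteq> 0"
    using assms by (auto simp: n_def vec_eq_iff forall_2)
  have nc: "n \<bullet> c = n \<bullet> ?m"
    by (simp add: n_def inner_vec_def sum_2 algebra_simps)
  have nab: "n \<bullet> a + n \<bullet> b = 2 * (n \<bullet> ?m)"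
    by (simp add: midpoint_def inner_simps)
  have le: "interior (convex hull {p, ?m, c}) \<subseteq> {x. n \<bullet> x < n \<bullet> ?m}" if "n \<bullet> p \<le> n \<bullet> ?m" for p
  proof -
    have "convex hull {p, ?m, c} \<subseteq> {x. n \<bullet> x \<le> n \<bullet> ?m}"
      using that nc by (intro hull_minimal convex_halfspace_le) auto
    then show ?thesis using interior_mono interior_halfspace_le[OF n0] by metis
  qed
  have ge: "interior (convex hull {p, ?m, c}) \<subseteq> {x. n \<bullet> x > n \<bullet> ?m}" if "n \<bullet> p \<ge> n \<bullet> ?m" for p
  proof -
    have "convex hull {p, ?m, c} \<subseteq> {x. n \<bullet> x \<ge> n \<bullet> ?m}"
      using that nc by (intro hull_minimal convex_halfspace_ge) auto
    then show ?thesis using interior_mono interior_halfspace_ge[OF n0] by metis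
  qed
  show ?thesis
  proof (cases "n \<bullet> a \<le> n \<bullet> ?m")
    case True
    then show ?thesis using le[of a] ge[of b] nab by fastforce
  next
    case False
    then show ?thesis using ge[of a] le[of b] nab by fastforce
  qed
qed

text \<open>
  That a triangle is not among its own children means that splitting it removes it from a partition;
  this drives the greedy algorithm.
\<close>

lemma bisect_partition:
  fixes T e :: triangle
  assumes "2 simplex T" "e edge_of T"
  shows "triangle_partition T (bisect T e)" and "T \<notin> bisect T e"
proof -
  obtain a b c where abc: "a \<noteq> b" "a \<noteq> c" "b \<noteq> c" "\<not> affine_dependent {a, b, c}"
    "T = convex hull {a, b, c}" "e = closed_segment a b"
    using edge_vertices[OF assms] .
  let ?m = "midpoint a b"
  let ?S = "convex hull {a, ?m, c}" and ?S' = "convex hull {b, ?m, c}"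
  have eq: "bisect T e = {?S, ?S'}" using bisect_eq[of a b c] abc by simp
  have S: "2 simplex ?S" using half_triangle_simplex[of a b c] abc by blast
  have S': "2 simplex ?S'"
    using half_triangle_simplex[of b a c] abc by (simp add: midpoint_sym insert_commute)
  have sub: "?S \<subseteq> T" "?S' \<subseteq> T"
    using half_triangle_subset[of a b c] half_triangle_subset[of b a c] abc
    by (auto simp: midpoint_sym insert_commute)
  have un: "?S \<union> ?S' = T" using sub triangle_subset_halves[of a b c] abc by auto
  have "?m \<noteq> c"
  proof
    assume "?m = c"
    then have "card {a, ?m, c} \<le> 2" by (simp add: card_insert_if)
    moreover have "aff_dim ?S \<le> int (card {a, ?m, c}) - 1"
      unfolding aff_dim_convex_hull by (rule aff_dim_le_card) simp
    ultimately show False using aff_dim_simplex[OF S] by linarith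
  qed
  then have disj: "interior ?S \<inter> interior ?S' = {}"
    by (rule halves_interiors_disjoint)
  show "triangle_partition T (bisect T e)"
    unfolding triangle_partition_def eq using S S' un disj
    by (auto simp: pairwise_insert Int_commute)
  show "T \<notin> bisect T e"
    using disj sub interior_mono interior_triangle_nonempty[OF S] interior_triangle_nonempty[OF S']
    unfolding eq by blast
qed

section \<open>Partitions into triangles\<close>

lemma partition_simplex: "triangle_partition \<Omega> \<P> \<Longrightarrow> T \<in> \<P> \<Longrightarrow> 2 simplex T"
  and partition_subset: "triangle_partition \<Omega> \<P> \<Longrightarrow> T \<in> \<P> \<Longrightarrow> T \<subseteq> \<Omega>"
  and partition_finite: "triangle_partition \<Omega> \<P> \<Longrightarrow> finite \<P>"
  and partition_Union: "triangle_partition \<Omega> \<P> \<Longrightarrow> \<Union>\<P> = \<Omega>"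
  and partition_disjoint: "triangle_partition \<Omega> \<P> \<Longrightarrow> S \<in> \<P> \<Longrightarrow> T \<in> \<P> \<Longrightarrow> S \<noteq> T \<Longrightarrow>
    interior S \<inter> interior T = {}"
  by (auto simp: triangle_partition_def pairwise_def)

lemma partition_subdivide:
  assumes P: "triangle_partition \<Omega> \<P>" and B: "\<And>T. T \<in> \<P> \<Longrightarrow> triangle_partition T (B T)"
  shows "triangle_partition \<Omega> (\<Union>T\<in>\<P>. B T)"
  unfolding triangle_partition_def
proof (intro conjI)
  show "finite (\<Union>T\<in>\<P>. B T)" by (intro finite_UN_I partition_finite[OF P] partition_finite[OF B])
  show "\<forall>T\<in>\<Union>T\<in>\<P>. B T. 2 simplex T" using partition_simplex[OF B] by blast
  show "\<Union>(\<Union>T\<in>\<P>. B T) = \<Omega>"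
  proof -
    have "\<Union>(\<Union>T\<in>\<P>. B T) = (\<Union>T\<in>\<P>. \<Union>(B T))" by blast
    also have "\<dots> = \<Union>\<P>" using partition_Union[OF B] by simp
    finally show ?thesis using partition_Union[OF P] by simp
  qed
  show "pairwise (\<lambda>S T. interior S \<inter> interior T = {}) (\<Union>T\<in>\<P>. B T)"
  proof (rule pairwiseI)
    fix S S' assume "S \<in> (\<Union>T\<in>\<P>. B T)" "S' \<in> (\<Union>T\<in>\<P>. B T)" and ne: "S \<noteq> S'"
    then obtain T T' where T: "T \<in> \<P>" "S \<in> B T" and T': "T' \<in> \<P>" "S' \<in> B T'" by blast
    show "interior S \<inter> interior S' = {}"
    proof (cases "T = T'")
      case True
      with T T' ne show ?thesis using partition_disjoint[OF B] by blast
    next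
      case False
      then have "interior T \<inter> interior T' = {}" using partition_disjoint[OF P] T T' by blast
      moreover have "S \<subseteq> T" "S' \<subseteq> T'" using partition_subset[OF B] T T' by blast+
      ultimately show ?thesis using interior_mono by blast
    qed
  qed
qed

text \<open>
  Otherwise the open set \<open>interior T\<close> would be covered by the boundaries of the elements of the
  partition, which are null sets.
\<close>

lemma partition_meets_triangle:
  assumes P: "triangle_partition \<Omega> \<P>" and T: "2 simplex T" "T \<subseteq> \<Omega>"
  obtains S where "S \<in> \<P>" "interior S \<inter> interior T \<noteq> {}"
proof (rule ccontr)
  assume "\<not> thesis"
  with that have none: "interior S \<inter> interior T = {}" if "S \<in> \<P>" for S using \<open>S \<in> \<P>\<close> by blast
  have "interior T \<subseteq> (\<Union>S\<in>\<P>. frontier S)"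
  proof
    fix x assume x: "x \<in> interior T"
    with T(2) interior_subset have "x \<in> \<Omega>" by blast
    then obtain S where S: "S \<in> \<P>" "x \<in> S" using partition_Union[OF P] by blast
    with none x have "x \<notin> interior S" by blast
    with S show "x \<in> (\<Union>S\<in>\<P>. frontier S)" using closure_subset by (auto simp: frontier_def)
  qed
  moreover have "negligible (\<Union>S\<in>\<P>. frontier S)"
    using partition_finite[OF P] partition_simplex[OF P]
    by (intro negligible_Union) (auto intro!: negligible_convex_frontier convex_simplex)
  ultimately have "negligible (interior T)" using negligible_subset by blast
  then show False using interior_triangle_nonempty[OF T(1)] open_not_negligible by blast
qed

lemma AE_lebesgue_on_iff:
  "S \<in> sets lebesgue \<Longrightarrow> (AE x in lebesgue_on S. P x) \<longleftrightarrow> (AE x in lebesgue. x \<in> S \<longrightarrow> P x)"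
  by (simp add: AE_restrict_space_iff)

lemma AE_lebesgue_on_subset:
  assumes "T \<subseteq> S" "T \<in> sets lebesgue" "S \<in> sets lebesgue" "AE x in lebesgue_on S. P x"
  shows "AE x in lebesgue_on T. P x"
proof -
  have "AE x in lebesgue. x \<in> S \<longrightarrow> P x" using assms(4) AE_lebesgue_on_iff[OF assms(3)] by simp
  then have "AE x in lebesgue. x \<in> T \<longrightarrow> P x"
    by (rule eventually_mono) (use assms(1) in auto)
  then show ?thesis using AE_lebesgue_on_iff[OF assms(2)] by simp
qed

lemma borel_measurable_lebesgue_on_AE:
  fixes f g :: plane_fun
  assumes S: "S \<in> sets lebesgue" and f: "f \<in> borel_measurable (lebesgue_on S)"
    and eq: "AE x in lebesgue_on S. f x = g x"
  shows "g \<in> borel_measurable (lebesgue_on S)"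
proof -
  have "(\<lambda>x. if x \<in> S then f x else 0) \<in> borel_measurable lebesgue"
    using borel_measurable_if[OF S] f by blast
  moreover have "AE x in lebesgue. (if x \<in> S then f x else 0) = (if x \<in> S then g x else 0)"
    using eq unfolding AE_lebesgue_on_iff[OF S] by eventually_elim auto
  ultimately have "(\<lambda>x. if x \<in> S then g x else 0) \<in> borel_measurable lebesgue"
    by (rule borel_measurable_AE)
  then show ?thesis using borel_measurable_if[OF S] by blast
qed

lemma triangle_lmeasurable: "2 simplex T \<Longrightarrow> (T :: triangle) \<in> lmeasurable"
  by (simp add: compact_simplex lmeasurable_compact)

lemma triangle_sets: "2 simplex T \<Longrightarrow> (T :: triangle) \<in> sets lebesgue"
  using triangle_lmeasurable fmeasurableD by blast

lemma triangle_not_negligible: "2 simplex T \<Longrightarrow> \<not> negligible (T :: triangle)"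
  using interior_triangle_nonempty[of T] open_not_negligible[of "interior T"]
    negligible_subset[of T "interior T"] interior_subset by auto

lemma AE_triangle_interior:
  assumes "2 simplex (T :: triangle)"
  shows "AE x in lebesgue. x \<in> T \<longleftrightarrow> x \<in> interior T"
proof -
  have "frontier T \<in> null_sets lebesgue"
    using negligible_convex_frontier[OF convex_simplex[OF assms]] by (simp add: negligible_iff_null_sets)
  then have "AE x in lebesgue. x \<notin> frontier T" by (rule AE_not_in)
  then show ?thesis
  proof (rule eventually_mono)
    fix x assume "x \<notin> frontier T"
    then show "x \<in> T \<longleftrightarrow> x \<in> interior T"
      using closure_subset interior_subset by (auto simp: frontier_def)
  qed
qed

text \<open>
  Outside the null set of all edges, a point lies in at most one element of the partition. This is
  the form in which overlapping edges are disregarded.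
\<close>

lemma AE_partition_interior:
  assumes "triangle_partition \<Omega> \<P>"
  shows "AE x in lebesgue. \<forall>T\<in>\<P>. x \<in> T \<longleftrightarrow> x \<in> interior T"
  using partition_finite[OF assms] AE_triangle_interior partition_simplex[OF assms]
  by (simp add: AE_ball_countable countable_finite)

lemma partition_sum_at_point:
  fixes F :: "triangle \<Rightarrow> real"
  assumes P: "triangle_partition \<Omega> \<P>" and T: "T \<in> \<P>" "x \<in> T"
    and x: "\<forall>T\<in>\<P>. x \<in> T \<longleftrightarrow> x \<in> interior T"
  shows "(\<Sum>S\<in>\<P>. indicat_real S x * F S) = F T"
proof -
  have "x \<notin> S" if "S \<in> \<P>" "S \<noteq> T" for S
    using partition_disjoint[OF P that(1) T(1) that(2)] x that(1) T by blast
  then have "(\<Sum>S\<in>\<P>. indicat_real S x * F S) = (\<Sum>S\<in>\<P>. if S = T then F S else 0)"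
    using T by (intro sum.cong) auto
  then show ?thesis using T partition_finite[OF P] by simp
qed

lemma partition_interior_sum_at_point:
  fixes F :: "triangle \<Rightarrow> real"
  assumes P: "triangle_partition \<Omega> \<P>" and T: "T \<in> \<P>" "x \<in> T"
    and x: "\<forall>T\<in>\<P>. x \<in> T \<longleftrightarrow> x \<in> interior T"
  shows "(\<Sum>S\<in>\<P>. indicat_real (interior S) x * F S) = F T"
proof -
  have "(\<Sum>S\<in>\<P>. indicat_real (interior S) x * F S) = (\<Sum>S\<in>\<P>. indicat_real S x * F S)"
    using x by (intro sum.cong) (auto split: split_indicator)
  then show ?thesis using partition_sum_at_point[OF assms] by simp
qed

lemma partition_compact:
  assumes P: "triangle_partition \<Omega> \<P>"
  shows "compact \<Omega>"
  unfolding partition_Union[OF P, symmetric]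
  using partition_finite[OF P] partition_simplex[OF P] compact_simplex by (intro compact_Union) auto

lemma partition_lmeasurable: "triangle_partition \<Omega> \<P> \<Longrightarrow> \<Omega> \<in> lmeasurable"
  using partition_compact lmeasurable_compact by blast

lemma partition_sets: "triangle_partition \<Omega> \<P> \<Longrightarrow> \<Omega> \<in> sets lebesgue"
  using partition_lmeasurable fmeasurableD by blast

lemma partition_AE_iff:
  assumes P: "triangle_partition \<Omega> \<P>"
  shows "(AE x in lebesgue_on \<Omega>. Q x) \<longleftrightarrow> (\<forall>T\<in>\<P>. AE x in lebesgue_on T. Q x)"
proof -
  have "(\<forall>T\<in>\<P>. AE x in lebesgue_on T. Q x) \<longleftrightarrow> (\<forall>T\<in>\<P>. AE x in lebesgue. x \<in> T \<longrightarrow> Q x)"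
    by (intro ball_cong refl AE_lebesgue_on_iff triangle_sets[OF partition_simplex[OF P]])
  also have "\<dots> \<longleftrightarrow> (AE x in lebesgue. \<forall>T\<in>\<P>. x \<in> T \<longrightarrow> Q x)"
    by (rule AE_ball_countable[OF countable_finite[OF partition_finite[OF P]], symmetric])
  also have "\<dots> \<longleftrightarrow> (AE x in lebesgue. x \<in> \<Omega> \<longrightarrow> Q x)"
  proof -
    have "(\<forall>T\<in>\<P>. x \<in> T \<longrightarrow> Q x) \<longleftrightarrow> (x \<in> \<Omega> \<longrightarrow> Q x)" for x
      using partition_Union[OF P] by blast
    then show ?thesis by (simp only:)
  qed
  also have "\<dots> \<longleftrightarrow> (AE x in lebesgue_on \<Omega>. Q x)"
    using AE_lebesgue_on_iff[OF partition_sets[OF P]] by simp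
  finally show ?thesis by simp
qed

section \<open>Norms and inner products over a partition\<close>

lemma powr_le_imp_le: "0 < r \<Longrightarrow> 0 \<le> y \<Longrightarrow> x powr r \<le> y powr r \<Longrightarrow> x \<le> y" for x y r :: real
  using powr_less_mono2[of r y x] by force

lemma ereal_exponent_cases:
  assumes "1 \<le> (p :: ereal)"
  obtains "p = \<infinity>" | r where "p = ereal r" "1 \<le> r"
proof (cases p)
  case (real r)
  with assms that(2) show thesis by simp
next
  case PInf
  with that(1) show thesis by simp
next
  case MInf
  with assms show thesis by simp
qed

lemma Lp_measurable: "f \<in> Lp p S \<Longrightarrow> f \<in> borel_measurable (lebesgue_on S)"
  by (simp add: Lp_def)

text \<open>
  This holds for all functions, because the conversion to reals sends the essential supremum
  \<open>- \<infinity>\<close> (on null sets) and \<open>\<infinity>\<close> (for functions that are not measurable) to \<open>0\<close>.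
\<close>

lemma Lp_norm_nonneg: "0 \<le> Lp_norm p S f"
proof (cases "p = \<infinity>")
  case True
  let ?M = "lebesgue_on S" and ?g = "\<lambda>x. ereal \<bar>f x\<bar>"
  have "0 \<le> real_of_ereal (esssup ?M ?g)"
  proof (cases "?g \<in> borel_measurable ?M")
    case False
    then show ?thesis by (simp add: esssup_non_measurable top_ereal_def)
  next
    case meas: True
    show ?thesis
    proof (cases "emeasure ?M (space ?M) = 0")
      case True
      then show ?thesis using esssup_zero_space[OF True meas] by simp
    next
      case False
      then have "esssup ?M (\<lambda>x. 0::ereal) = 0" by (rule esssup_const)
      moreover have "esssup ?M (\<lambda>x. 0::ereal) \<le> esssup ?M ?g" by (rule esssup_mono) auto
      ultimately show ?thesis by (simp add: real_of_ereal_pos)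
    qed
  qed
  with True show ?thesis by (simp add: Lp_norm_def)
qed (simp add: Lp_norm_def)

text \<open>
  Null sets have to be excluded: there the right-hand side holds for negative \<open>c\<close>, too.
\<close>

lemma Lp_norm_infty_le_iff:
  assumes S: "S \<in> sets lebesgue" "\<not> negligible S" and f: "f \<in> Lp \<infinity> S"
  shows "Lp_norm \<infinity> S f \<le> c \<longleftrightarrow> (AE x in lebesgue_on S. \<bar>f x\<bar> \<le> c)"
proof -
  let ?M = "lebesgue_on S" and ?g = "\<lambda>x. ereal \<bar>f x\<bar>"
  have meas: "?g \<in> borel_measurable ?M" and fin: "esssup ?M ?g < \<infinity>"
    using f by (auto simp: Lp_def)
  have "emeasure ?M (space ?M) \<noteq> 0"
    using S by (auto simp: emeasure_restrict_space negligible_iff_null_sets null_sets_def)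
  then have "esssup ?M (\<lambda>x. 0::ereal) = 0" by (rule esssup_const)
  moreover have "esssup ?M (\<lambda>x. 0::ereal) \<le> esssup ?M ?g" by (rule esssup_mono) auto
  ultimately have eq: "esssup ?M ?g = ereal (Lp_norm \<infinity> S f)"
    using fin by (cases "esssup ?M ?g") (auto simp: Lp_norm_def)
  show ?thesis
  proof
    assume "Lp_norm \<infinity> S f \<le> c"
    with esssup_AE[of ?g ?M] show "AE x in ?M. \<bar>f x\<bar> \<le> c"
      unfolding eq by (auto elim!: eventually_mono)
  next
    assume "AE x in ?M. \<bar>f x\<bar> \<le> c"
    then have "AE x in ?M. ?g x \<le> ereal c" by simp
    then have "esssup ?M ?g \<le> ereal c" by (rule esssup_I[OF meas])
    then show "Lp_norm \<infinity> S f \<le> c" unfolding eq by simp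
  qed
qed

lemma Lp_norm_powr:
  "1 \<le> r \<Longrightarrow> Lp_norm (ereal r) S f powr r = (LINT x|lebesgue_on S. \<bar>f x\<bar> powr r)"
  by (simp add: Lp_norm_def powr_powr)

lemma
  assumes S: "S \<in> sets lebesgue" and f: "f \<in> borel_measurable (lebesgue_on S)"
    and eq: "AE x in lebesgue_on S. f x = g x"
  shows Lp_norm_cong_AE: "Lp_norm p S f = Lp_norm p S g"
    and Lp_cong_AE: "f \<in> Lp p S \<longleftrightarrow> g \<in> Lp p S"
proof -
  let ?M = "lebesgue_on S"
  note g = borel_measurable_lebesgue_on_AE[OF assms]
  have *: "esssup ?M (\<lambda>x. ereal \<bar>f x\<bar>) = esssup ?M (\<lambda>x. ereal \<bar>g x\<bar>)"
    using f g eq by (intro esssup_AE_cong) (auto elim: eventually_mono)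
  have **: "(LINT x|?M. \<bar>f x\<bar> powr real_of_ereal p) = (LINT x|?M. \<bar>g x\<bar> powr real_of_ereal p)"
    using f g eq by (intro integral_cong_AE) (auto elim: eventually_mono)
  have ***: "integrable ?M (\<lambda>x. \<bar>f x\<bar> powr real_of_ereal p) \<longleftrightarrow>
    integrable ?M (\<lambda>x. \<bar>g x\<bar> powr real_of_ereal p)"
    using f g eq by (intro integrable_cong_AE) (auto elim: eventually_mono)
  show "Lp_norm p S f = Lp_norm p S g" by (simp add: Lp_norm_def * **)
  show "f \<in> Lp p S \<longleftrightarrow> g \<in> Lp p S" using f g by (simp add: Lp_def * ***)
qed

lemma Lp_subset:
  assumes "T \<subseteq> S" "T \<in> sets lebesgue" "S \<in> sets lebesgue" and f: "f \<in> Lp p S"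
  shows "f \<in> Lp p T"
proof -
  have meas: "f \<in> borel_measurable (lebesgue_on T)"
    using measurable_restrict_mono[OF Lp_measurable[OF f] assms(1)] .
  show ?thesis
  proof (cases "p = \<infinity>")
    case True
    have "AE x in lebesgue_on T. ereal \<bar>f x\<bar> \<le> esssup (lebesgue_on S) (\<lambda>x. ereal \<bar>f x\<bar>)"
      by (rule AE_lebesgue_on_subset[OF assms(1-3) esssup_AE])
    then have "esssup (lebesgue_on T) (\<lambda>x. ereal \<bar>f x\<bar>) \<le> esssup (lebesgue_on S) (\<lambda>x. ereal \<bar>f x\<bar>)"
      using meas by (intro esssup_I) auto
    with f True meas show ?thesis by (auto simp: Lp_def)
  next
    case False
    let ?h = "\<lambda>x. \<bar>f x\<bar> powr real_of_ereal p"
    have "integrable lebesgue (\<lambda>x. indicat_real S x *\<^sub>R ?h x)"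
      using f False assms(3) by (simp add: Lp_def integrable_restrict_space)
    then have "integrable lebesgue (\<lambda>x. indicat_real T x *\<^sub>R (indicat_real S x *\<^sub>R ?h x))"
      by (rule integrable_mult_indicator[OF assms(2)])
    moreover have "(\<lambda>x. indicat_real T x *\<^sub>R (indicat_real S x *\<^sub>R ?h x)) = (\<lambda>x. indicat_real T x *\<^sub>R ?h x)"
      using assms(1) by (intro ext) (auto split: split_indicator)
    ultimately show ?thesis using False meas assms(2) by (simp add: Lp_def integrable_restrict_space)
  qed
qed

lemma Lp_bounded:
  assumes p: "1 \<le> p" and S: "S \<in> lmeasurable" and f: "f \<in> borel_measurable (lebesgue_on S)"
    and B: "AE x in lebesgue_on S. \<bar>f x\<bar> \<le> B"
  shows "f \<in> Lp p S"
proof (cases rule: ereal_exponent_cases[OF p])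
  case 1
  have "esssup (lebesgue_on S) (\<lambda>x. ereal \<bar>f x\<bar>) \<le> ereal B"
    using f B by (intro esssup_I) auto
  with 1 f show ?thesis by (auto simp: Lp_def)
next
  case (2 r)
  interpret finite_measure "lebesgue_on S" using S by (rule finite_measure_lebesgue_on)
  have "integrable (lebesgue_on S) (\<lambda>x. \<bar>f x\<bar> powr r)"
  proof (rule integrable_const_bound)
    show "AE x in lebesgue_on S. norm (\<bar>f x\<bar> powr r) \<le> B powr r"
      using B by eventually_elim (use 2 in \<open>auto intro: powr_mono2\<close>)
  qed (use f in measurable)
  with 2 f show ?thesis by (simp add: Lp_def)
qed

text \<open>
  For \<open>p < \<infinity>\<close>, integrability follows from the pointwise bound \<open>\<bar>a - b\<bar> \<le> 2 max \<bar>a\<bar> \<bar>b\<bar>\<close>.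
\<close>

lemma Lp_diff:
  assumes p: "1 \<le> p" and f: "f \<in> Lp p S" and g: "g \<in> Lp p S"
  shows "(\<lambda>x. f x - g x) \<in> Lp p S"
proof -
  let ?M = "lebesgue_on S"
  have meas[measurable]: "f \<in> borel_measurable ?M" "g \<in> borel_measurable ?M"
    using f g Lp_measurable by auto
  show ?thesis
  proof (cases rule: ereal_exponent_cases[OF p])
    case 1
    have "esssup ?M (\<lambda>x. ereal \<bar>f x - g x\<bar>) \<le> esssup ?M (\<lambda>x. ereal \<bar>f x\<bar> + ereal \<bar>g x\<bar>)"
      by (rule esssup_mono) (auto intro: abs_triangle_ineq4)
    also have "\<dots> \<le> esssup ?M (\<lambda>x. ereal \<bar>f x\<bar>) + esssup ?M (\<lambda>x. ereal \<bar>g x\<bar>)"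
      by (rule esssup_add)
    also have "\<dots> < \<infinity>" using f g 1 by (auto simp: Lp_def)
    finally show ?thesis using 1 by (simp add: Lp_def)
  next
    case (2 r)
    have "integrable ?M (\<lambda>x. \<bar>f x - g x\<bar> powr r)"
    proof (rule Bochner_Integration.integrable_bound)
      show "integrable ?M (\<lambda>x. 2 powr r * (\<bar>f x\<bar> powr r + \<bar>g x\<bar> powr r))"
        using f g 2 by (intro integrable_mult_right Bochner_Integration.integrable_add) (auto simp: Lp_def)
      have "\<bar>f x - g x\<bar> powr r \<le> 2 powr r * (\<bar>f x\<bar> powr r + \<bar>g x\<bar> powr r)" for x
      proof -
        have "\<bar>f x - g x\<bar> powr r \<le> (2 * max \<bar>f x\<bar> \<bar>g x\<bar>) powr r"
          using 2 by (intro powr_mono2) auto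
        also have "\<dots> = 2 powr r * max \<bar>f x\<bar> \<bar>g x\<bar> powr r"
          by (simp add: powr_mult)
        also have "\<dots> \<le> 2 powr r * (\<bar>f x\<bar> powr r + \<bar>g x\<bar> powr r)"
          by (auto simp: max_def)
        finally show ?thesis .
      qed
      then show "AE x in ?M. norm (\<bar>f x - g x\<bar> powr r) \<le> norm (2 powr r * (\<bar>f x\<bar> powr r + \<bar>g x\<bar> powr r))"
        by auto
    qed measurable
    with 2 show ?thesis by (simp add: Lp_def)
  qed
qed

lemma Lp_norm_mono_set:
  assumes p: "1 \<le> p" and "T \<subseteq> S" "T \<in> sets lebesgue" "S \<in> sets lebesgue" "\<not> negligible T" and f: "f \<in> Lp p S"
  shows "Lp_norm p T f \<le> Lp_norm p S f"
proof (cases rule: ereal_exponent_cases[OF p])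
  case 1
  have "\<not> negligible S" using assms(2,5) negligible_subset by blast
  then have "AE x in lebesgue_on S. \<bar>f x\<bar> \<le> Lp_norm p S f"
    using Lp_norm_infty_le_iff[OF assms(4), of f] f 1 by auto
  then have "AE x in lebesgue_on T. \<bar>f x\<bar> \<le> Lp_norm p S f"
    by (rule AE_lebesgue_on_subset[OF assms(2-4)])
  then show ?thesis
    using Lp_norm_infty_le_iff[OF assms(3,5), of f] Lp_subset[OF assms(2-4) f] 1 by auto
next
  case (2 r)
  have "(LINT x|lebesgue_on T. \<bar>f x\<bar> powr r) \<le> (LINT x|lebesgue_on S. \<bar>f x\<bar> powr r)"
  proof (rule integral_mono_lebesgue_on_AE)
    show "integrable (lebesgue_on S) (\<lambda>x. \<bar>f x\<bar> powr r)" using f 2 by (simp add: Lp_def)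
  qed (use assms(2-4) in simp_all)
  then have "Lp_norm p T f powr r \<le> Lp_norm p S f powr r" using 2 by (simp add: Lp_norm_powr)
  with 2 show ?thesis by (intro powr_le_imp_le[OF _ Lp_norm_nonneg, of r]) simp_all
qed

lemma partition_borel_measurable:
  assumes P: "triangle_partition \<Omega> \<P>" and h: "\<And>T. T \<in> \<P> \<Longrightarrow> h \<in> borel_measurable (lebesgue_on T)"
  shows "h \<in> borel_measurable (lebesgue_on \<Omega>)"
proof (rule measurable_piecewise_restrict)
  show "countable \<P>" using partition_finite[OF P] by (rule countable_finite)
  fix T assume T: "T \<in> \<P>"
  have eq: "T \<inter> \<Omega> = T" using partition_subset[OF P T] by blast
  show "T \<inter> space (lebesgue_on \<Omega>) \<in> sets (lebesgue_on \<Omega>)"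
    using triangle_sets[OF partition_simplex[OF P T]] partition_sets[OF P]
    using partition_subset[OF P T] by (simp add: sets_restrict_space_iff eq)
  have "restrict_space (lebesgue_on \<Omega>) T = lebesgue_on T"
    using partition_sets[OF P] triangle_sets[OF partition_simplex[OF P T]] eq
    by (subst restrict_restrict_space) (auto simp: Int_commute)
  then show "h \<in> borel_measurable (restrict_space (lebesgue_on \<Omega>) T)" using h[OF T] by simp
next
  show "space (lebesgue_on \<Omega>) \<subseteq> \<Union>\<P>" using partition_Union[OF P] by simp
qed

lemma partition_integral:
  fixes h :: plane_fun
  assumes P: "triangle_partition \<Omega> \<P>" and h: "integrable (lebesgue_on \<Omega>) h"
  shows "(LINT x|lebesgue_on \<Omega>. h x) = (\<Sum>T\<in>\<P>. LINT x|lebesgue_on T. h x)"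
proof -
  note \<Omega> = partition_sets[OF P]
  have T: "T \<in> sets lebesgue" if "T \<in> \<P>" for T using triangle_sets[OF partition_simplex[OF P that]] .
  have h\<Omega>: "integrable lebesgue (\<lambda>x. indicat_real \<Omega> x * h x)"
    using h \<Omega> by (simp add: integrable_restrict_space)
  have hT: "integrable lebesgue (\<lambda>x. indicat_real T x * h x)" if "T \<in> \<P>" for T
  proof -
    have "(\<lambda>x. indicat_real T x * h x) = (\<lambda>x. indicat_real T x *\<^sub>R (indicat_real \<Omega> x * h x))"
      using partition_subset[OF P that] by (intro ext) (auto split: split_indicator)
    then show ?thesis using integrable_mult_indicator[OF T[OF that] h\<Omega>] by simp
  qed
  have "AE x in lebesgue. indicat_real \<Omega> x * h x = (\<Sum>T\<in>\<P>. indicat_real T x * h x)"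
    using AE_partition_interior[OF P]
  proof (rule eventually_mono)
    fix x assume x: "\<forall>T\<in>\<P>. x \<in> T \<longleftrightarrow> x \<in> interior T"
    show "indicat_real \<Omega> x * h x = (\<Sum>T\<in>\<P>. indicat_real T x * h x)"
    proof (cases "x \<in> \<Omega>")
      case True
      then obtain T where "T \<in> \<P>" "x \<in> T" using partition_Union[OF P] by blast
      then show ?thesis using partition_sum_at_point[OF P _ _ x] True by simp
    next
      case False
      then have "x \<notin> T" if "T \<in> \<P>" for T using partition_subset[OF P that] by blast
      with False show ?thesis by simp
    qed
  qed
  then have "(LINT x|lebesgue. indicat_real \<Omega> x * h x) = (LINT x|lebesgue. (\<Sum>T\<in>\<P>. indicat_real T x * h x))"
    using h\<Omega> hT by (intro integral_cong_AE) auto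
  also have "\<dots> = (\<Sum>T\<in>\<P>. LINT x|lebesgue. indicat_real T x * h x)"
    using hT by (rule Bochner_Integration.integral_sum)
  finally show ?thesis using T \<Omega> by (simp add: integral_restrict_space)
qed

lemma partition_Lp_norm_powr:
  assumes P: "triangle_partition \<Omega> \<P>" and r: "1 \<le> r" and h: "h \<in> Lp (ereal r) \<Omega>"
  shows "Lp_norm (ereal r) \<Omega> h powr r = (\<Sum>T\<in>\<P>. Lp_norm (ereal r) T h powr r)"
proof -
  have "integrable (lebesgue_on \<Omega>) (\<lambda>x. \<bar>h x\<bar> powr r)" using h by (simp add: Lp_def)
  from partition_integral[OF P this] show ?thesis using r by (simp add: Lp_norm_powr)
qed

lemma partition_Lp_norm_infty:
  assumes P: "triangle_partition \<Omega> \<P>" and "\<P> \<noteq> {}" and h: "h \<in> Lp \<infinity> \<Omega>"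
  shows "Lp_norm \<infinity> \<Omega> h = Max ((\<lambda>T. Lp_norm \<infinity> T h) ` \<P>)"
proof -
  obtain T0 where T0: "T0 \<in> \<P>" using \<open>\<P> \<noteq> {}\<close> by blast
  have \<Omega>: "\<Omega> \<in> sets lebesgue" "\<not> negligible \<Omega>"
    using partition_sets[OF P] triangle_not_negligible[OF partition_simplex[OF P T0]]
      negligible_subset[OF _ partition_subset[OF P T0]] by auto
  \<comment> \<open>Both sides have the same upper bounds.\<close>
  have le_iff: "Lp_norm \<infinity> \<Omega> h \<le> c \<longleftrightarrow> Max ((\<lambda>T. Lp_norm \<infinity> T h) ` \<P>) \<le> c" for c
  proof -
    have "Lp_norm \<infinity> T h \<le> c \<longleftrightarrow> (AE x in lebesgue_on T. \<bar>h x\<bar> \<le> c)" if "T \<in> \<P>" for T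
      using Lp_norm_infty_le_iff Lp_subset[OF partition_subset[OF P that] _ \<Omega>(1) h]
        triangle_not_negligible triangle_sets partition_simplex[OF P that] by simp
    then have "Lp_norm \<infinity> \<Omega> h \<le> c \<longleftrightarrow> (\<forall>T\<in>\<P>. Lp_norm \<infinity> T h \<le> c)"
      using Lp_norm_infty_le_iff[OF \<Omega> h] partition_AE_iff[OF P] by simp
    then show ?thesis using partition_finite[OF P] \<open>\<P> \<noteq> {}\<close> by simp
  qed
  show ?thesis using le_iff[of "Lp_norm \<infinity> \<Omega> h"] le_iff[of "Max ((\<lambda>T. Lp_norm \<infinity> T h) ` \<P>)"] by simp
qed

section \<open>Piecewise polynomial functions\<close>

lemma Poly_continuous: "\<pi> \<in> Poly m \<Longrightarrow> continuous_on S \<pi>"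
proof -
  assume "\<pi> \<in> Poly m"
  then obtain c where c: "\<And>x. \<pi> x = (\<Sum>i\<le>m. \<Sum>j\<le>m - i. c i j * (x $ 1) ^ i * (x $ 2) ^ j)"
    by (auto simp: Poly_def)
  have "\<pi> = (\<lambda>x. \<Sum>i\<le>m. \<Sum>j\<le>m - i. c i j * (x $ 1) ^ i * (x $ 2) ^ j)" using c by blast
  then show ?thesis by (simp add: continuous_intros)
qed

lemma Poly_linear:
  assumes "\<pi> \<in> Poly m" "\<rho> \<in> Poly m"
  shows "(\<lambda>x. a * \<pi> x + b * \<rho> x) \<in> Poly m"
proof -
  obtain c d where "\<And>x. \<pi> x = (\<Sum>i\<le>m. \<Sum>j\<le>m - i. c i j * (x $ 1) ^ i * (x $ 2) ^ j)"
    "\<And>x. \<rho> x = (\<Sum>i\<le>m. \<Sum>j\<le>m - i. d i j * (x $ 1) ^ i * (x $ 2) ^ j)"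
    using assms by (auto simp: Poly_def)
  then have "a * \<pi> x + b * \<rho> x =
      (\<Sum>i\<le>m. \<Sum>j\<le>m - i. (a * c i j + b * d i j) * (x $ 1) ^ i * (x $ 2) ^ j)" for x
    by (simp add: sum_distrib_left sum.distrib[symmetric] distrib_right mult.assoc)
  then show ?thesis unfolding Poly_def
    by (intro CollectI exI[of _ "\<lambda>i j. a * c i j + b * d i j"]) blast
qed

lemma Poly_zero: "(\<lambda>x. 0) \<in> Poly m"
  unfolding Poly_def by (rule CollectI, rule exI[of _ "\<lambda>i j. 0"]) simp

lemma continuous_measurable_lebesgue_on:
  fixes g :: plane_fun
  assumes "S \<in> sets lebesgue" "continuous_on S g"
  shows "g \<in> borel_measurable (lebesgue_on S)"
  using assms by (rule continuous_imp_measurable_on_sets_lebesgue[rotated])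

lemma continuous_Lp:
  assumes p: "1 \<le> p" and S: "compact S" and g: "continuous_on S g"
  shows "g \<in> Lp p S"
proof -
  have lm: "S \<in> lmeasurable" using S by (rule lmeasurable_compact)
  obtain B where B: "\<And>x. x \<in> S \<Longrightarrow> \<bar>g x\<bar> \<le> B"
    using compact_imp_bounded[OF compact_continuous_image[OF g S]] by (auto simp: bounded_iff)
  show ?thesis
  proof (rule Lp_bounded[OF p lm])
    show "g \<in> borel_measurable (lebesgue_on S)"
      by (rule continuous_measurable_lebesgue_on[OF fmeasurableD[OF lm] g])
    show "AE x in lebesgue_on S. \<bar>g x\<bar> \<le> B" using B by (intro AE_I2) simp
  qed
qed

text \<open>
  On each triangle the function agrees almost everywhere with a continuous function on a compact
  set, so it is measurable and essentially bounded.
\<close>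

lemma V_level_Lp:
  assumes p: "1 \<le> p" and P: "triangle_partition \<Omega> \<P>" and g: "g \<in> V_level m \<P>"
  shows "g \<in> Lp p \<Omega>"
proof -
  have piece: "g \<in> borel_measurable (lebesgue_on T) \<and> (\<exists>B. AE x in lebesgue_on T. \<bar>g x\<bar> \<le> B)"
    if TP: "T \<in> \<P>" for T
  proof -
    note T = partition_simplex[OF P TP]
    obtain \<pi> where \<pi>: "\<pi> \<in> Poly m" "AE x in lebesgue_on T. g x = \<pi> x"
      using g TP unfolding V_level_def by blast
    obtain B where B: "\<And>x. x \<in> T \<Longrightarrow> \<bar>\<pi> x\<bar> \<le> B"
      using compact_imp_bounded[OF compact_continuous_image[OF Poly_continuous[OF \<pi>(1)] compact_simplex[OF T]]]
      by (auto simp: bounded_iff)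
    have "AE x in lebesgue_on T. \<pi> x = g x" using \<pi>(2) by (rule eventually_mono) simp
    then have "g \<in> borel_measurable (lebesgue_on T)"
      by (rule borel_measurable_lebesgue_on_AE[OF triangle_sets[OF T]
          continuous_measurable_lebesgue_on[OF triangle_sets[OF T] Poly_continuous[OF \<pi>(1)]]])
    moreover have "AE x in lebesgue_on T. \<bar>g x\<bar> \<le> B"
    proof -
      have "AE x in lebesgue_on T. x \<in> T" by (rule AE_I2) simp
      with \<pi>(2) show ?thesis by eventually_elim (use B in simp)
    qed
    ultimately show ?thesis by blast
  qed
  then obtain B where B: "\<And>T. T \<in> \<P> \<Longrightarrow> AE x in lebesgue_on T. \<bar>g x\<bar> \<le> B T" by metis
  have fin: "finite \<P>" using P by (rule partition_finite)
  have "AE x in lebesgue_on \<Omega>. \<bar>g x\<bar> \<le> (\<Sum>T\<in>\<P>. \<bar>B T\<bar>)"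
    unfolding partition_AE_iff[OF P]
  proof
    fix T assume T: "T \<in> \<P>"
    have "\<bar>B T\<bar> \<le> (\<Sum>T\<in>\<P>. \<bar>B T\<bar>)" using fin T by (intro member_le_sum) auto
    then have *: "B T \<le> (\<Sum>T\<in>\<P>. \<bar>B T\<bar>)" by linarith
    show "AE x in lebesgue_on T. \<bar>g x\<bar> \<le> (\<Sum>T\<in>\<P>. \<bar>B T\<bar>)"
      using B[OF T] by (rule eventually_mono) (use * in linarith)
  qed
  moreover have "g \<in> borel_measurable (lebesgue_on \<Omega>)"
    using piece by (intro partition_borel_measurable[OF P]) blast
  ultimately show ?thesis using Lp_bounded[OF p partition_lmeasurable[OF P]] by blast
qed

lemma V_levelD: "g \<in> V_level m \<P> \<Longrightarrow> T \<in> \<P> \<Longrightarrow> \<exists>\<pi>\<in>Poly m. AE x in lebesgue_on T. g x = \<pi> x"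
  by (simp add: V_level_def)

lemma V_level_linear:
  assumes "g \<in> V_level m \<P>" "h \<in> V_level m \<P>"
  shows "(\<lambda>x. a * g x + b * h x) \<in> V_level m \<P>"
  unfolding V_level_def
proof (intro CollectI ballI)
  fix T assume T: "T \<in> \<P>"
  obtain \<pi> \<rho> where \<pi>: "\<pi> \<in> Poly m" "AE x in lebesgue_on T. g x = \<pi> x"
    and \<rho>: "\<rho> \<in> Poly m" "AE x in lebesgue_on T. h x = \<rho> x"
    using V_levelD[OF assms(1) T] V_levelD[OF assms(2) T] by blast
  have "AE x in lebesgue_on T. a * g x + b * h x = a * \<pi> x + b * \<rho> x"
    using \<pi>(2) \<rho>(2) by eventually_elim simp
  then show "\<exists>\<pi>\<in>Poly m. AE x in lebesgue_on T. a * g x + b * h x = \<pi> x"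
    by (rule bexI[where x = "\<lambda>x. a * \<pi> x + b * \<rho> x"]) (rule Poly_linear[OF \<pi>(1) \<rho>(1)])
qed

lemma V_level_zero: "(\<lambda>x. 0) \<in> V_level m \<P>"
  unfolding V_level_def using Poly_zero by auto

lemma V_level_sum:
  assumes "finite I" "\<And>i. i \<in> I \<Longrightarrow> b i \<in> V_level m \<P>"
  shows "(\<lambda>x. \<Sum>i\<in>I. c i * b i x) \<in> V_level m \<P>"
  using assms
proof (induction I rule: finite_induct)
  case empty
  then show ?case using V_level_zero by simp
next
  case (insert i I)
  then show ?case using V_level_linear[of "b i" m \<P> "\<lambda>x. \<Sum>i\<in>I. c i * b i x" "c i" 1] by simp
qed

lemma Poly_onI: "\<pi> \<in> Poly m \<Longrightarrow> (\<lambda>x. indicat_real T x * \<pi> x) \<in> Poly_on m T"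
  by (auto simp: Poly_on_def)

lemma Poly_on_outside:
  assumes "g \<in> Poly_on m T"
  shows "AE x in lebesgue. x \<notin> T \<longrightarrow> g x = 0"
proof -
  obtain \<pi> where "AE x in lebesgue. g x = indicat_real T x * \<pi> x"
    using assms by (auto simp: Poly_on_def)
  then show ?thesis by (rule eventually_mono) simp
qed

lemma Poly_sum_outside:
  assumes "g \<in> Poly_sum m \<C>" "finite \<C>" "\<And>S. S \<in> \<C> \<Longrightarrow> S \<subseteq> T"
  shows "AE x in lebesgue. x \<notin> T \<longrightarrow> g x = 0"
proof -
  obtain h where h: "g = (\<lambda>x. \<Sum>S\<in>\<C>. h S x)" "\<And>S. S \<in> \<C> \<Longrightarrow> h S \<in> Poly_on m S"
    using assms(1) by (auto simp: Poly_sum_def)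
  have "AE x in lebesgue. \<forall>S\<in>\<C>. x \<notin> S \<longrightarrow> h S x = 0"
    unfolding AE_ball_countable[OF countable_finite[OF assms(2)]] using Poly_on_outside h(2) by blast
  then show ?thesis
  proof (rule eventually_mono, intro impI)
    fix x assume "\<forall>S\<in>\<C>. x \<notin> S \<longrightarrow> h S x = 0" "x \<notin> T"
    then show "g x = 0" unfolding h(1) using assms(3) by (intro sum.neutral) blast
  qed
qed

section \<open>Local approximation\<close>

lemma function_class_subset:
  assumes X: "function_class p X" and f: "f \<in> X S" and "T \<subseteq> S" "T \<in> sets lebesgue" "S \<in> sets lebesgue"
  shows "f \<in> X T"
proof -
  consider "X = Lp p" | "X = (\<lambda>S. {g. continuous_on S g})"
    using X by (auto simp: function_class_def)
  then show ?thesis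
  proof cases
    case 1
    with assms Lp_subset show ?thesis by blast
  next
    case 2
    with f show ?thesis using continuous_on_subset[OF _ \<open>T \<subseteq> S\<close>] by simp
  qed
qed

lemma function_class_Lp:
  assumes X: "function_class p X" and p: "1 \<le> p" and "compact S" and f: "f \<in> X S"
  shows "f \<in> Lp p S"
proof -
  consider "X = Lp p" | "X = (\<lambda>S. {g. continuous_on S g})"
    using X by (auto simp: function_class_def)
  then show ?thesis using f continuous_Lp[OF p \<open>compact S\<close>] by cases auto
qed

lemma local_approximation_Poly:
  assumes "local_approximation p m X A" "2 simplex T" "f \<in> X T"
  shows "A T f \<in> Poly m"
proof -
  have "A T ` X T = Poly m" using assms(1,2) unfolding local_approximation_def by blast
  then show ?thesis using assms(3) by blast
qed

text \<open>
  The constant may be taken at least \<open>1\<close>, hence positive, because the infimum is nonnegative.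
\<close>

lemma local_approximation_near_best:
  assumes "local_approximation p m X A"
  obtains C where "1 \<le> C"
    "\<And>T g \<pi>. 2 simplex T \<Longrightarrow> g \<in> X T \<Longrightarrow> \<pi> \<in> Poly m \<Longrightarrow>
      local_error p A g T \<le> C * Lp_norm p T (\<lambda>x. g x - \<pi> x)"
proof -
  obtain C where C: "\<And>T g. 2 simplex T \<Longrightarrow> g \<in> X T \<Longrightarrow> Lp_norm p T (\<lambda>x. g x - A T g x)
      \<le> C * (INF \<pi>\<in>Poly m. Lp_norm p T (\<lambda>x. g x - \<pi> x))"
    using assms unfolding local_approximation_def by blast
  have "local_error p A g T \<le> max C 1 * Lp_norm p T (\<lambda>x. g x - \<pi> x)"
    if "2 simplex T" "g \<in> X T" and \<pi>: "\<pi> \<in> Poly m" for T g \<pi>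
  proof -
    let ?I = "INF \<pi>\<in>Poly m. Lp_norm p T (\<lambda>x. g x - \<pi> x)"
    have I0: "0 \<le> ?I" using \<pi> Lp_norm_nonneg by (intro cINF_greatest) auto
    have "bdd_below ((\<lambda>\<pi>. Lp_norm p T (\<lambda>x. g x - \<pi> x)) ` Poly m)"
      using Lp_norm_nonneg by (intro bdd_belowI[of _ 0]) blast
    then have I: "?I \<le> Lp_norm p T (\<lambda>x. g x - \<pi> x)" using \<pi> by (rule cINF_lower)
    have "local_error p A g T \<le> C * ?I" using C[OF that(1,2)] by (simp add: local_error_def)
    also have "\<dots> \<le> max C 1 * ?I" using I0 by (intro mult_right_mono) auto
    also have "\<dots> \<le> max C 1 * Lp_norm p T (\<lambda>x. g x - \<pi> x)" using I by (intro mult_left_mono) auto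
    finally show ?thesis .
  qed
  then show thesis by (intro that[of "max C 1"]) auto
qed

lemma local_error_nonneg: "0 \<le> local_error p A f T"
  by (simp add: local_error_def Lp_norm_nonneg)

lemma piecewise_approx_on_piece:
  assumes P: "triangle_partition \<Omega> \<P>" and T: "T \<in> \<P>"
  shows "AE x in lebesgue_on T. piecewise_approx A f \<P> x = A T f x"
  unfolding AE_lebesgue_on_iff[OF triangle_sets[OF partition_simplex[OF P T]]]
  using AE_partition_interior[OF P]
proof (rule eventually_mono, intro impI)
  fix x assume "\<forall>T\<in>\<P>. x \<in> T \<longleftrightarrow> x \<in> interior T" "x \<in> T"
  then show "piecewise_approx A f \<P> x = A T f x"
    unfolding piecewise_approx_def using partition_interior_sum_at_point[OF P T, of x "\<lambda>T. A T f x"] by simp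
qed

section \<open>Orthonormal systems in the space of square integrable functions\<close>

lemma L2_iff:
  "f \<in> Lp (ereal 2) S \<longleftrightarrow> f \<in> borel_measurable (lebesgue_on S) \<and> integrable (lebesgue_on S) (\<lambda>x. (f x)\<^sup>2)"
  "f \<in> Lp 2 S \<longleftrightarrow> f \<in> borel_measurable (lebesgue_on S) \<and> integrable (lebesgue_on S) (\<lambda>x. (f x)\<^sup>2)"
  by (simp_all add: Lp_def)

lemma L2_norm_square: "(Lp_norm 2 S f)\<^sup>2 = L2_inner S f f"
proof -
  have "(Lp_norm 2 S f)\<^sup>2 = Lp_norm 2 S f powr 2" by (simp add: Lp_norm_nonneg)
  also have "\<dots> = (LINT x|lebesgue_on S. \<bar>f x\<bar> powr 2)"
    using Lp_norm_powr[of 2 S f] by simp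
  finally show ?thesis by (simp add: L2_inner_def power2_eq_square)
qed

lemma L2_mult_integrable:
  assumes "f \<in> Lp 2 S" "g \<in> Lp 2 S"
  shows "integrable (lebesgue_on S) (\<lambda>x. f x * g x)"
proof (rule Bochner_Integration.integrable_bound)
  show "integrable (lebesgue_on S) (\<lambda>x. (f x)\<^sup>2 + (g x)\<^sup>2)"
    using assms by (simp add: L2_iff)
  show "(\<lambda>x. f x * g x) \<in> borel_measurable (lebesgue_on S)"
    using assms[THEN Lp_measurable] by (rule borel_measurable_times)
  have "norm (f x * g x) \<le> norm ((f x)\<^sup>2 + (g x)\<^sup>2)" for x
  proof -
    have "0 \<le> (\<bar>f x\<bar> - \<bar>g x\<bar>)\<^sup>2" by simp
    then have "2 * (\<bar>f x\<bar> * \<bar>g x\<bar>) \<le> (f x)\<^sup>2 + (g x)\<^sup>2" by (simp add: power2_diff)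
    moreover have "0 \<le> \<bar>f x\<bar> * \<bar>g x\<bar>" by simp
    ultimately have "\<bar>f x\<bar> * \<bar>g x\<bar> \<le> (f x)\<^sup>2 + (g x)\<^sup>2" by linarith
    then show ?thesis by (simp add: abs_mult)
  qed
  then show "AE x in lebesgue_on S. norm (f x * g x) \<le> norm ((f x)\<^sup>2 + (g x)\<^sup>2)" by simp
qed

lemma L2_inner_commute: "L2_inner S f g = L2_inner S g f"
  by (simp add: L2_inner_def mult.commute)

lemma L2_linear:
  assumes "f \<in> Lp 2 S" "g \<in> Lp 2 S"
  shows "(\<lambda>x. a * f x + b * g x) \<in> Lp 2 S"
proof -
  have "(a * f x + b * g x)\<^sup>2 = a\<^sup>2 * (f x)\<^sup>2 + b\<^sup>2 * (g x)\<^sup>2 + 2 * a * b * (f x * g x)" for x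
    by (simp add: power2_eq_square algebra_simps)
  then have "integrable (lebesgue_on S) (\<lambda>x. (a * f x + b * g x)\<^sup>2)"
    using assms L2_mult_integrable[OF assms] by (simp add: L2_iff)
  moreover have "(\<lambda>x. a * f x + b * g x) \<in> borel_measurable (lebesgue_on S)"
    by (intro borel_measurable_add borel_measurable_times borel_measurable_const assms[THEN Lp_measurable])
  ultimately show ?thesis unfolding L2_iff by blast
qed

lemma L2_inner_linear:
  assumes "f \<in> Lp 2 S" "g \<in> Lp 2 S" "h \<in> Lp 2 S"
  shows "L2_inner S (\<lambda>x. a * f x + b * g x) h = a * L2_inner S f h + b * L2_inner S g h"
proof -
  have "(a * f x + b * g x) * h x = a * (f x * h x) + b * (g x * h x)" for x
    by (simp add: algebra_simps)
  then show ?thesis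
    using L2_mult_integrable[OF assms(1,3)] L2_mult_integrable[OF assms(2,3)]
    by (simp add: L2_inner_def)
qed

lemma L2_sum:
  assumes "finite I" "\<And>i. i \<in> I \<Longrightarrow> b i \<in> Lp 2 S"
  shows "(\<lambda>x. \<Sum>i\<in>I. c i * b i x) \<in> Lp 2 S"
  using assms
proof (induction I rule: finite_induct)
  case empty
  then show ?case by (simp add: L2_iff)
next
  case (insert i I)
  then show ?case using L2_linear[of "b i" S "\<lambda>x. \<Sum>i\<in>I. c i * b i x" "c i" 1] by simp
qed

lemma L2_inner_sum:
  assumes "finite I" "\<And>i. i \<in> I \<Longrightarrow> b i \<in> Lp 2 S" "h \<in> Lp 2 S"
  shows "L2_inner S (\<lambda>x. \<Sum>i\<in>I. c i * b i x) h = (\<Sum>i\<in>I. c i * L2_inner S (b i) h)"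
  using assms(1,2)
proof (induction I rule: finite_induct)
  case empty
  then show ?case by (simp add: L2_inner_def)
next
  case (insert i I)
  then show ?case
    using L2_inner_linear[of "b i" S "\<lambda>x. \<Sum>i\<in>I. c i * b i x" h "c i" 1] L2_sum[of I b S c] \<open>h \<in> Lp 2 S\<close>
    by simp
qed

lemma L2_diff: "f \<in> Lp 2 S \<Longrightarrow> g \<in> Lp 2 S \<Longrightarrow> (\<lambda>x. f x - g x) \<in> Lp 2 S"
  using L2_linear[of f S g 1 "-1"] by simp

lemma L2_inner_diff:
  "f \<in> Lp 2 S \<Longrightarrow> g \<in> Lp 2 S \<Longrightarrow> h \<in> Lp 2 S \<Longrightarrow>
    L2_inner S (\<lambda>x. f x - g x) h = L2_inner S f h - L2_inner S g h"
  using L2_inner_linear[of f S g h 1 "-1"] by simp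

lemma L2_inner_cong_AE:
  assumes S: "S \<in> sets lebesgue" and f: "f \<in> Lp 2 S" "h \<in> Lp 2 S" and eq: "AE x in lebesgue_on S. f x = g x"
  shows "L2_inner S f h = L2_inner S g h"
proof -
  have "g \<in> Lp 2 S" using Lp_cong_AE[OF S Lp_measurable[OF f(1)] eq] f(1) by simp
  then show ?thesis
    unfolding L2_inner_def using f eq
    by (intro integral_cong_AE borel_measurable_times Lp_measurable) (auto elim: eventually_mono)
qed

lemma L2_inner_restrict:
  assumes T: "T \<subseteq> S" "T \<in> sets lebesgue" "S \<in> sets lebesgue" and fg: "f \<in> Lp 2 S" "g \<in> Lp 2 S"
    and supp: "AE x in lebesgue. x \<notin> T \<longrightarrow> f x = 0"
  shows "L2_inner S f g = L2_inner T f g"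
proof -
  have fg': "f \<in> Lp 2 T" "g \<in> Lp 2 T" using Lp_subset[OF T] fg by auto
  have "(LINT x|lebesgue. indicat_real S x * (f x * g x)) = (LINT x|lebesgue. indicat_real T x * (f x * g x))"
  proof (rule integral_cong_AE)
    show "AE x in lebesgue. indicat_real S x * (f x * g x) = indicat_real T x * (f x * g x)"
      using supp by (rule eventually_mono) (use T(1) in \<open>auto split: split_indicator\<close>)
    show "(\<lambda>x. indicat_real S x * (f x * g x)) \<in> borel_measurable lebesgue"
      using borel_measurable_integrable[OF L2_mult_integrable[OF fg]] T(3)
      by (simp add: borel_measurable_restrict_space_iff)
    show "(\<lambda>x. indicat_real T x * (f x * g x)) \<in> borel_measurable lebesgue"
      using borel_measurable_integrable[OF L2_mult_integrable[OF fg']] T(2)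
      by (simp add: borel_measurable_restrict_space_iff)
  qed
  then show ?thesis using T by (simp add: L2_inner_def integral_restrict_space)
qed

lemma L2_inner_self_eq_0:
  assumes f: "f \<in> Lp 2 S" and h: "h \<in> Lp 2 S" and S: "S \<in> sets lebesgue" and "L2_inner S f f = 0"
  shows "L2_inner S h f = 0"
proof -
  have "AE x in lebesgue_on S. f x * f x = 0"
    using assms(4) L2_mult_integrable[OF f f] unfolding L2_inner_def
    by (subst (asm) integral_nonneg_eq_0_iff_AE) auto
  then have "AE x in lebesgue_on S. h x * f x = 0" by (rule eventually_mono) simp
  then show ?thesis unfolding L2_inner_def by (rule integral_eq_zero_AE)
qed

text \<open>
  Orthogonal projection onto the span of finitely many functions, by the Gram-Schmidt process. The
  functions \<open>b i\<close> may be linearly dependent.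
\<close>

lemma L2_projection:
  assumes "finite I" and S: "S \<in> sets lebesgue" and "\<And>i. i \<in> I \<Longrightarrow> b i \<in> Lp 2 S" and "h \<in> Lp 2 S"
  shows "\<exists>c. \<forall>i\<in>I. L2_inner S (\<lambda>x. h x - (\<Sum>j\<in>I. c j * b j x)) (b i) = 0"
  using assms(1,3,4)
proof (induction I arbitrary: h rule: finite_induct)
  case empty
  then show ?case by simp
next
  case (insert k I)
  have bI: "b i \<in> Lp 2 S" if "i \<in> I" for i using insert.prems(1) that by blast
  have bk: "b k \<in> Lp 2 S" using insert.prems(1) by blast
  note h = \<open>h \<in> Lp 2 S\<close>
  obtain c where c: "\<And>i. i \<in> I \<Longrightarrow> L2_inner S (\<lambda>x. h x - (\<Sum>j\<in>I. c j * b j x)) (b i) = 0"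
    using insert.IH[OF bI h] by blast
  obtain d where d: "\<And>i. i \<in> I \<Longrightarrow> L2_inner S (\<lambda>x. b k x - (\<Sum>j\<in>I. d j * b j x)) (b i) = 0"
    using insert.IH[OF bI bk] by blast
  define h0 where "h0 = (\<lambda>x. h x - (\<Sum>j\<in>I. c j * b j x))"
  define b' where "b' = (\<lambda>x. b k x - (\<Sum>j\<in>I. d j * b j x))"
  have h0: "h0 \<in> Lp 2 S" unfolding h0_def using h L2_sum[OF insert.hyps(1) bI] by (intro L2_diff) auto
  have b': "b' \<in> Lp 2 S" unfolding b'_def using bk L2_sum[OF insert.hyps(1) bI] by (intro L2_diff) auto
  \<comment> \<open>If \<open>b'\<close> vanishes almost everywhere, any value of \<open>t\<close> will do; the quotient is then \<open>0\<close>.\<close>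
  define t where "t = L2_inner S h0 b' / L2_inner S b' b'"
  define h1 where "h1 = (\<lambda>x. 1 * h0 x + (- t) * b' x)"
  have h1: "h1 \<in> Lp 2 S" unfolding h1_def using h0 b' by (rule L2_linear)
  have h1_inner: "L2_inner S h1 g = L2_inner S h0 g - t * L2_inner S b' g" if "g \<in> Lp 2 S" for g
    unfolding h1_def using L2_inner_linear[OF h0 b' that, of 1 "- t"] by simp
  have h1_I: "L2_inner S h1 (b i) = 0" if "i \<in> I" for i
    using h1_inner[OF bI[OF that]] c[OF that] d[OF that] by (simp add: h0_def b'_def)
  have "L2_inner S h1 b' = 0"
  proof (cases "L2_inner S b' b' = 0")
    case True
    then show ?thesis using L2_inner_self_eq_0[OF b' h1 S] by simp
  next
    case False
    then show ?thesis using h1_inner[OF b'] by (simp add: t_def)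
  qed
  moreover have "L2_inner S h1 b' = L2_inner S h1 (b k) - (\<Sum>j\<in>I. d j * L2_inner S h1 (b j))"
    unfolding L2_inner_commute[of S h1] b'_def
    using L2_inner_diff[OF bk L2_sum[OF insert.hyps(1) bI] h1] L2_inner_sum[OF insert.hyps(1) bI h1] by simp
  ultimately have h1_k: "L2_inner S h1 (b k) = 0" using h1_I by simp
  define c' where "c' = (\<lambda>j. if j = k then t else c j - t * d j)"
  have "h1 = (\<lambda>x. h x - (\<Sum>j\<in>insert k I. c' j * b j x))"
  proof
    fix x
    have "(\<Sum>j\<in>I. c' j * b j x) = (\<Sum>j\<in>I. c j * b j x - t * (d j * b j x))"
      using insert.hyps by (intro sum.cong) (auto simp: c'_def algebra_simps)
    also have "\<dots> = (\<Sum>j\<in>I. c j * b j x) - t * (\<Sum>j\<in>I. d j * b j x)"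
      by (simp add: sum_subtractf sum_distrib_left)
    finally show "h1 x = h x - (\<Sum>j\<in>insert k I. c' j * b j x)"
      using insert.hyps by (simp add: h1_def h0_def b'_def c'_def algebra_simps)
  qed
  then have "\<forall>i\<in>insert k I. L2_inner S (\<lambda>x. h x - (\<Sum>j\<in>insert k I. c' j * b j x)) (b i) = 0"
    using h1_I h1_k by simp
  then show ?case by blast
qed

text \<open>
  The Pythagorean identity: the squared distance to a combination of an orthonormal family splits into
  the squared distance to the orthogonal projection and the squared deviation of the coefficients.
\<close>

lemma orthonormal_distance:
  assumes F: "finite F" and w: "\<And>l. l \<in> F \<Longrightarrow> w l \<in> Lp 2 S" and f: "f \<in> Lp 2 S"
    and on: "\<And>k l. k \<in> F \<Longrightarrow> l \<in> F \<Longrightarrow> L2_inner S (w k) (w l) = (if k = l then 1 else 0)"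
  shows "(Lp_norm 2 S (\<lambda>x. f x - (\<Sum>l\<in>F. c l * w l x)))\<^sup>2 =
    L2_inner S f f - (\<Sum>l\<in>F. (L2_inner S f (w l))\<^sup>2) + (\<Sum>l\<in>F. (c l - L2_inner S f (w l))\<^sup>2)"
proof -
  let ?u = "\<lambda>x. \<Sum>l\<in>F. c l * w l x"
  let ?a = "\<lambda>l. L2_inner S f (w l)"
  note u = L2_sum[OF F w, where c = c]
  have uf: "L2_inner S ?u f = (\<Sum>l\<in>F. c l * ?a l)"
    using L2_inner_sum[OF F w f] by (simp add: L2_inner_commute[of S f])
  have uw: "L2_inner S ?u (w k) = c k" if k: "k \<in> F" for k
  proof -
    have "L2_inner S ?u (w k) = (\<Sum>l\<in>F. c l * L2_inner S (w l) (w k))"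
      by (rule L2_inner_sum[OF F w w[OF k]])
    also have "\<dots> = (\<Sum>l\<in>F. if l = k then c l else 0)"
      using on k by (intro sum.cong) auto
    finally show ?thesis using F k by simp
  qed
  have "L2_inner S ?u ?u = (\<Sum>l\<in>F. c l * L2_inner S (w l) ?u)"
    by (rule L2_inner_sum[OF F w u])
  also have "\<dots> = (\<Sum>l\<in>F. c l * c l)"
    using uw by (intro sum.cong) (auto simp: L2_inner_commute[of S _ ?u])
  finally have uu: "L2_inner S ?u ?u = (\<Sum>l\<in>F. (c l)\<^sup>2)" by (simp add: power2_eq_square)
  have "L2_inner S (\<lambda>x. f x - ?u x) (\<lambda>x. f x - ?u x) = L2_inner S f f - 2 * L2_inner S ?u f + L2_inner S ?u ?u"
    using L2_inner_diff[OF f u L2_diff[OF f u]] L2_inner_diff[OF f u f] L2_inner_diff[OF f u u]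
    by (simp add: L2_inner_commute[of S f "\<lambda>x. f x - ?u x"] L2_inner_commute[of S ?u "\<lambda>x. f x - ?u x"]
        L2_inner_commute[of S f ?u])
  also have "\<dots> = L2_inner S f f - (\<Sum>l\<in>F. (?a l)\<^sup>2) + (\<Sum>l\<in>F. (c l - ?a l)\<^sup>2)"
    unfolding uf uu by (simp add: power2_diff sum.distrib sum_subtractf sum_distrib_left algebra_simps)
  finally show ?thesis unfolding L2_norm_square .
qed

lemma Bessel:
  assumes "finite F" "\<And>l. l \<in> F \<Longrightarrow> w l \<in> Lp 2 S" "f \<in> Lp 2 S"
    "\<And>k l. k \<in> F \<Longrightarrow> l \<in> F \<Longrightarrow> L2_inner S (w k) (w l) = (if k = l then 1 else 0)"
  shows "(\<Sum>l\<in>F. (L2_inner S f (w l))\<^sup>2) \<le> L2_inner S f f"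
  using orthonormal_distance[OF assms, where c = "\<lambda>l. L2_inner S f (w l)"]
    zero_le_power2[of "Lp_norm 2 S (\<lambda>x. f x - (\<Sum>l\<in>F. L2_inner S f (w l) * w l x))"]
  by simp

text \<open>
  By Bessel's inequality there are at most \<open>\<langle>f, f\<rangle> / \<epsilon>\<^sup>2\<close> coefficients of modulus at least \<open>\<epsilon>\<close>.
\<close>

lemma finitely_many_large_coefficients:
  assumes w: "\<And>l. l \<in> \<Lambda> \<Longrightarrow> w l \<in> Lp 2 S" and f: "f \<in> Lp 2 S"
    and on: "\<And>k l. k \<in> \<Lambda> \<Longrightarrow> l \<in> \<Lambda> \<Longrightarrow> L2_inner S (w k) (w l) = (if k = l then 1 else 0)"
    and "0 < \<epsilon>"
  shows "finite {l \<in> \<Lambda>. \<bar>L2_inner S f (w l)\<bar> \<ge> \<epsilon>}" (is "finite ?B")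
proof (rule ccontr)
  assume inf: "infinite ?B"
  obtain n :: nat where n: "L2_inner S f f / \<epsilon>\<^sup>2 < n" using reals_Archimedean2 by blast
  obtain F where F: "F \<subseteq> ?B" "finite F" "card F = n"
    using infinite_arbitrarily_large[OF inf] by blast
  have "L2_inner S f f < n * \<epsilon>\<^sup>2" using n \<open>0 < \<epsilon>\<close> by (simp add: field_simps)
  also have "\<dots> = (\<Sum>l\<in>F. \<epsilon>\<^sup>2)" using F by simp
  also have "\<dots> \<le> (\<Sum>l\<in>F. (L2_inner S f (w l))\<^sup>2)"
  proof (rule sum_mono)
    fix l assume "l \<in> F"
    then have "\<epsilon> \<le> \<bar>L2_inner S f (w l)\<bar>" using F(1) by blast
    then show "\<epsilon>\<^sup>2 \<le> (L2_inner S f (w l))\<^sup>2"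
      using \<open>0 < \<epsilon>\<close> power_mono[of \<epsilon> "\<bar>L2_inner S f (w l)\<bar>" 2] by simp
  qed
  also have "\<dots> \<le> L2_inner S f f"
  proof (rule Bessel[OF F(2) _ f])
    fix k l assume "k \<in> F" "l \<in> F"
    with F(1) show "L2_inner S (w k) (w l) = (if k = l then 1 else 0)" by (intro on) blast+
  qed (use F(1) w in blast)
  finally show False by simp
qed

text \<open>
  Let a combination over \<open>F\<close> be within \<open>\<delta>\<close> of \<open>f\<close>. If \<open>\<epsilon>\<close> is smaller than all nonzero coefficients
  of \<open>f\<close> with index in \<open>F\<close>, then enlarging the index set of the thresholded sum by \<open>F\<close> only adds
  zero terms. So this sum is the orthogonal projection of \<open>f\<close> onto a span that contains the given
  combination.
\<close>

lemma threshold_tendsto: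
  assumes w: "\<And>l. l \<in> \<Lambda> \<Longrightarrow> w l \<in> Lp 2 S" and f: "f \<in> Lp 2 S"
    and on: "\<And>k l. k \<in> \<Lambda> \<Longrightarrow> l \<in> \<Lambda> \<Longrightarrow> L2_inner S (w k) (w l) = (if k = l then 1 else 0)"
    and dense: "\<And>\<delta>. 0 < \<delta> \<Longrightarrow>
      \<exists>F c. finite F \<and> F \<subseteq> \<Lambda> \<and> Lp_norm 2 S (\<lambda>x. f x - (\<Sum>l\<in>F. c l * w l x)) < \<delta>"
  shows "((\<lambda>\<epsilon>. Lp_norm 2 S (\<lambda>x. f x -
      (\<Sum>l\<in>{l \<in> \<Lambda>. \<bar>L2_inner S f (w l)\<bar> \<ge> \<epsilon>}. L2_inner S f (w l) * w l x))) \<longlongrightarrow> 0) (at_right 0)"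
    (is "(?E \<longlongrightarrow> 0) _")
proof (rule order_tendstoI)
  fix a :: real assume "a < 0"
  then have "a < ?E \<epsilon>" for \<epsilon> using Lp_norm_nonneg by (rule less_le_trans)
  then show "\<forall>\<^sub>F \<epsilon> in at_right 0. a < ?E \<epsilon>" by simp
next
  let ?a = "\<lambda>l. L2_inner S f (w l)"
  fix \<delta> :: real assume "0 < \<delta>"
  then obtain F c where F: "finite F" "F \<subseteq> \<Lambda>"
    and lt: "Lp_norm 2 S (\<lambda>x. f x - (\<Sum>l\<in>F. c l * w l x)) < \<delta>"
    using dense by blast
  \<comment> \<open>The element \<open>1\<close> only keeps the minimum meaningful when all coefficients in question vanish.\<close>
  define M where "M = insert 1 ((\<lambda>l. \<bar>?a l\<bar>) ` {l \<in> F. ?a l \<noteq> 0})"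
  have finM: "finite M" and M0: "M \<noteq> {}" using F by (auto simp: M_def)
  have "0 < Min M" using finM M0 by (auto simp: M_def)
  moreover have "?E \<epsilon> < \<delta>" if \<epsilon>: "0 < \<epsilon>" "\<epsilon> < Min M" for \<epsilon>
  proof -
    let ?B = "{l \<in> \<Lambda>. \<bar>?a l\<bar> \<ge> \<epsilon>}"
    define G where "G = ?B \<union> F"
    have finB: "finite ?B" using finitely_many_large_coefficients[OF w f on \<epsilon>(1)] .
    have finG: "finite G" using finB F by (simp add: G_def)
    have G: "G \<subseteq> \<Lambda>" using F by (auto simp: G_def)
    have zero: "?a l = 0" if "l \<in> G - ?B" for l
    proof (rule ccontr)
      assume "?a l \<noteq> 0"
      moreover have l: "l \<in> F" using that by (auto simp: G_def)
      ultimately have "Min M \<le> \<bar>?a l\<bar>" using finM by (intro Min_le) (auto simp: M_def)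
      with \<epsilon> l F(2) have "l \<in> ?B" by auto
      with that show False by blast
    qed
    define c' where "c' = (\<lambda>l. if l \<in> F then c l else 0)"
    have B_eq: "(\<Sum>l\<in>?B. ?a l * w l x) = (\<Sum>l\<in>G. ?a l * w l x)" for x
    proof (rule sum.mono_neutral_left[OF finG])
      show "?B \<subseteq> G" by (simp add: G_def)
    qed (intro ballI, simp only: zero mult_zero_left)
    have F_eq: "(\<Sum>l\<in>F. c l * w l x) = (\<Sum>l\<in>G. c' l * w l x)" for x
    proof (rule sum.mono_neutral_cong_left[OF finG])
      show "F \<subseteq> G" by (simp add: G_def)
    qed (simp_all add: c'_def)
    have dist: "(Lp_norm 2 S (\<lambda>x. f x - (\<Sum>l\<in>G. d l * w l x)))\<^sup>2 =
      L2_inner S f f - (\<Sum>l\<in>G. (?a l)\<^sup>2) + (\<Sum>l\<in>G. (d l - ?a l)\<^sup>2)" for d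
    proof (rule orthonormal_distance[OF finG _ f])
      fix k l assume "k \<in> G" "l \<in> G"
      with G show "L2_inner S (w k) (w l) = (if k = l then 1 else 0)" by (intro on) blast+
    qed (use G w in blast)
    have "(?E \<epsilon>)\<^sup>2 = L2_inner S f f - (\<Sum>l\<in>G. (?a l)\<^sup>2)"
      using dist[of ?a] by (simp add: B_eq)
    also have "\<dots> \<le> L2_inner S f f - (\<Sum>l\<in>G. (?a l)\<^sup>2) + (\<Sum>l\<in>G. (c' l - ?a l)\<^sup>2)"
      by (simp add: sum_nonneg)
    also have "\<dots> = (Lp_norm 2 S (\<lambda>x. f x - (\<Sum>l\<in>F. c l * w l x)))\<^sup>2"
      using dist[of c'] by (simp add: F_eq)
    finally have "?E \<epsilon> \<le> Lp_norm 2 S (\<lambda>x. f x - (\<Sum>l\<in>F. c l * w l x))"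
      by (rule power2_le_imp_le) (rule Lp_norm_nonneg)
    with lt show ?thesis by simp
  qed
  ultimately show "\<forall>\<^sub>F \<epsilon> in at_right 0. ?E \<epsilon> < \<delta>"
    by (intro eventually_at_rightI[of 0 "Min M"]) auto
qed

definition monomials :: "nat \<Rightarrow> (nat \<times> nat) set" where
  "monomials m = Sigma {..m} (\<lambda>i. {..m - i})"

definition monomial :: "nat \<times> nat \<Rightarrow> plane_fun" where
  "monomial k x = (x $ 1) ^ fst k * (x $ 2) ^ snd k"

lemma finite_monomials: "finite (monomials m)"
  by (simp add: monomials_def)

lemma monomial_sum:
  "(\<Sum>k\<in>monomials m. c k * monomial k x) = (\<Sum>i\<le>m. \<Sum>j\<le>m - i. c (i, j) * (x $ 1) ^ i * (x $ 2) ^ j)"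
  by (simp add: monomials_def monomial_def sum.Sigma mult.assoc split_def)

lemma monomial_sum_Poly: "(\<lambda>x. \<Sum>k\<in>monomials m. c k * monomial k x) \<in> Poly m"
  unfolding Poly_def by (rule CollectI, rule exI[of _ "\<lambda>i j. c (i, j)"]) (simp add: monomial_sum)

lemma Poly_monomial_sum:
  assumes "\<pi> \<in> Poly m"
  obtains c where "\<pi> = (\<lambda>x. \<Sum>k\<in>monomials m. c k * monomial k x)"
proof -
  obtain c where c: "\<And>x. \<pi> x = (\<Sum>i\<le>m. \<Sum>j\<le>m - i. c i j * (x $ 1) ^ i * (x $ 2) ^ j)"
    using assms by (auto simp: Poly_def)
  have "\<pi> = (\<lambda>x. \<Sum>k\<in>monomials m. (case k of (i, j) \<Rightarrow> c i j) * monomial k x)"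
    by (simp add: monomial_sum c fun_eq_iff)
  with that show thesis by blast
qed

lemma Poly_projection:
  assumes T: "2 simplex T" and h: "h \<in> Lp 2 T"
  obtains q where "q \<in> Poly m" "\<forall>\<rho>\<in>Poly m. L2_inner T (\<lambda>x. h x - q x) \<rho> = 0"
proof -
  note Ts = triangle_sets[OF T]
  have mono: "monomial k \<in> Lp 2 T" for k
  proof (rule continuous_Lp[OF _ compact_simplex[OF T]])
    have "monomial k = (\<lambda>x. (x $ 1) ^ fst k * (x $ 2) ^ snd k)" by (auto simp: monomial_def)
    then show "continuous_on T (monomial k)" by (simp add: continuous_intros)
  qed simp
  obtain c where c: "\<And>k. k \<in> monomials m \<Longrightarrow>
      L2_inner T (\<lambda>x. h x - (\<Sum>j\<in>monomials m. c j * monomial j x)) (monomial k) = 0"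
    using L2_projection[OF finite_monomials[of m] Ts, of monomial, OF mono h] by blast
  define q where "q = (\<lambda>x. \<Sum>j\<in>monomials m. c j * monomial j x)"
  have q: "q \<in> Poly m" unfolding q_def by (rule monomial_sum_Poly)
  have hq: "(\<lambda>x. h x - q x) \<in> Lp 2 T"
    unfolding q_def using h L2_sum[OF finite_monomials mono] by (rule L2_diff)
  have "L2_inner T (\<lambda>x. h x - q x) \<rho> = 0" if \<rho>_Poly: "\<rho> \<in> Poly m" for \<rho>
  proof -
    obtain d where \<rho>: "\<rho> = (\<lambda>x. \<Sum>k\<in>monomials m. d k * monomial k x)"
      using Poly_monomial_sum[OF \<rho>_Poly] .
    have "L2_inner T (\<lambda>x. h x - q x) \<rho> = (\<Sum>k\<in>monomials m. d k * L2_inner T (monomial k) (\<lambda>x. h x - q x))"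
      unfolding \<rho> L2_inner_commute[of T "\<lambda>x. h x - q x"] by (rule L2_inner_sum[OF finite_monomials mono hq])
    also have "\<dots> = 0"
    proof (rule sum.neutral, rule ballI)
      fix k assume "k \<in> monomials m"
      from c[OF this] show "d k * L2_inner T (monomial k) (\<lambda>x. h x - q x) = 0"
        unfolding q_def by (simp add: L2_inner_commute[of T "monomial k"])
    qed
    finally show ?thesis .
  qed
  with q that show thesis by blast
qed

section \<open>The hierarchy of bisected triangles\<close>

lemma greedy_step:
  assumes "greedy_partitions p A R f D0 \<T>" and "card D0 \<le> N"
  shows "\<exists>T. is_arg_max (local_error p A f) (\<lambda>T. T \<in> \<T> N) T \<and>
      \<T> (Suc N) = (\<T> N - {T}) \<union> bisect T (R f T)"
proof -
  have "\<forall>N>card D0. \<exists>T. is_arg_max (local_error p A f) (\<lambda>T. T \<in> \<T> (N - 1)) T \<and>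
      \<T> N = (\<T> (N - 1) - {T}) \<union> bisect T (R f T)"
    using assms(1) unfolding greedy_partitions_def by (rule conjunct2)
  from this[rule_format, of "Suc N"] assms(2) show ?thesis by simp
qed

lemma greedy_initial_nonempty:
  assumes "greedy_partitions p A R f D0 \<T>"
  shows "D0 \<noteq> {}"
proof -
  have "\<T> (card D0) = D0" using assms by (simp add: greedy_partitions_def)
  then show ?thesis using greedy_step[OF assms order_refl] by (auto simp: is_arg_max_def)
qed

context
  fixes R :: "plane_fun \<Rightarrow> triangle \<Rightarrow> (real^2) set" and f :: plane_fun
    and \<Omega> :: "(real^2) set" and D0 :: "triangle set"
  assumes R: "refinement_rule R" and D0: "triangle_partition \<Omega> D0"
begin

abbreviation (input) "level \<equiv> hierarchy R f D0"

lemma bisect_rule_partition: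
  assumes "2 simplex T"
  shows "triangle_partition T (bisect T (R f T))" "T \<notin> bisect T (R f T)"
  using bisect_partition[OF assms] R assms by (auto simp: refinement_rule_def)

lemma hierarchy_partition: "triangle_partition \<Omega> (level j)"
proof (induction j)
  case 0
  then show ?case using D0 by simp
next
  case (Suc j)
  then show ?case
    by (simp, rule partition_subdivide) (auto intro: bisect_rule_partition(1) partition_simplex)
qed

lemma hierarchy_ancestor:
  "i \<le> j \<Longrightarrow> T \<in> level j \<Longrightarrow> \<exists>S\<in>level i. T \<subseteq> S"
proof (induction j arbitrary: T rule: dec_induct)
  case base
  then show ?case by blast
next
  case (step j)
  then obtain S where S: "S \<in> level j" "T \<in> bisect S (R f S)" by auto
  then have "2 simplex S" using partition_simplex[OF hierarchy_partition] by blast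
  then have "T \<subseteq> S" using partition_subset[OF bisect_rule_partition(1)] S(2) by blast
  with step.IH[OF S(1)] show ?case by blast
qed

text \<open>
  The ancestor of \<open>T\<close> on the level of \<open>S\<close> either is \<open>S\<close> or has interior disjoint from that of \<open>S\<close>.
\<close>

lemma hierarchy_nested:
  assumes "i \<le> j" and S: "S \<in> level i" and T: "T \<in> level j"
  shows "interior S \<inter> interior T = {} \<or> T = S \<or> (\<exists>S'\<in>bisect S (R f S). T \<subseteq> S')"
proof (cases "i = j")
  case True
  then show ?thesis using partition_disjoint[OF hierarchy_partition] S T by blast
next
  case False
  with \<open>i \<le> j\<close> have "Suc i \<le> j" by simp
  then obtain S' where S': "S' \<in> level (Suc i)" "T \<subseteq> S'"
    using hierarchy_ancestor T by blast
  then obtain S0 where S0: "S0 \<in> level i" "S' \<in> bisect S0 (R f S0)" by auto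
  show ?thesis
  proof (cases "S0 = S")
    case True
    with S0 S' show ?thesis by blast
  next
    case False
    then have "interior S \<inter> interior S0 = {}"
      using partition_disjoint[OF hierarchy_partition] S S0 by blast
    moreover have "S' \<subseteq> S0"
      using partition_subset[OF bisect_rule_partition(1) S0(2)]
        partition_simplex[OF hierarchy_partition S0(1)] by blast
    then have "interior T \<subseteq> interior S0" using S'(2) by (intro interior_mono) blast
    ultimately show ?thesis by blast
  qed
qed

text \<open>
  Let \<open>J\<close> bound the levels of the finitely many elements of the partition. A triangle of level
  \<open>J\<close> meets the interior of some element, and nestedness then forces it to lie inside.
\<close>

lemma tree_partition_coarser_than_level:
  assumes P: "triangle_partition \<Omega> \<P>" and sub: "\<P> \<subseteq> (\<Union>j. level j)"
  obtains J where "\<And>T. T \<in> level J \<Longrightarrow> \<exists>S\<in>\<P>. T \<subseteq> S"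
proof -
  obtain l where l: "\<And>S. S \<in> \<P> \<Longrightarrow> S \<in> level (l S)"
    using sub by (metis UN_E subsetD)
  define J where "J = Max (l ` \<P>)"
  have J: "l S \<le> J" if "S \<in> \<P>" for S
    unfolding J_def using that partition_finite[OF P] by simp
  have "\<exists>S\<in>\<P>. T \<subseteq> S" if T: "T \<in> level J" for T
  proof -
    obtain S where S: "S \<in> \<P>" "interior S \<inter> interior T \<noteq> {}"
      using partition_meets_triangle[OF P] partition_simplex[OF hierarchy_partition T]
        partition_subset[OF hierarchy_partition T] .
    then consider "T = S" | S' where "S' \<in> bisect S (R f S)" "T \<subseteq> S'"
      using hierarchy_nested[OF J[OF S(1)] l[OF S(1)] T] by blast
    then have "T \<subseteq> S"
      using partition_subset[OF bisect_rule_partition(1)] partition_simplex[OF P S(1)] by cases blast+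
    with S show ?thesis by blast
  qed
  with that show thesis by blast
qed

lemma greedy_tree_partition:
  assumes G: "greedy_partitions p A R f D0 \<T>" and "card D0 \<le> N"
  shows "triangle_partition \<Omega> (\<T> N) \<and> \<T> N \<subseteq> (\<Union>j. level j)"
  using \<open>card D0 \<le> N\<close>
proof (induction N rule: dec_induct)
  case base
  have "D0 \<subseteq> level 0" by simp
  then have "D0 \<subseteq> (\<Union>j. level j)" by blast
  moreover have "\<T> (card D0) = D0" using G by (simp add: greedy_partitions_def)
  ultimately show ?case using D0 by simp
next
  case (step N)
  obtain T where T: "T \<in> \<T> N" and eq: "\<T> (Suc N) = (\<T> N - {T}) \<union> bisect T (R f T)"
    using greedy_step[OF G step.hyps(1)] by (auto simp: is_arg_max_def)
  have eq': "\<T> (Suc N) = (\<Union>S\<in>\<T> N. if S = T then bisect T (R f T) else {S})"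
    using T unfolding eq by auto
  have simp: "2 simplex S" if "S \<in> \<T> N" for S using partition_simplex step.IH that by blast
  have "triangle_partition \<Omega> (\<T> (Suc N))"
    unfolding eq'
  proof (rule partition_subdivide)
    fix S assume S: "S \<in> \<T> N"
    show "triangle_partition S (if S = T then bisect T (R f T) else {S})"
      using bisect_rule_partition(1)[of T] simp[OF S] by (auto simp: triangle_partition_def)
  qed (use step.IH in blast)
  moreover obtain j where "T \<in> level j" using step.IH T by blast
  then have "bisect T (R f T) \<subseteq> level (Suc j)" by auto
  then have "\<T> (Suc N) \<subseteq> (\<Union>j. level j)"
    unfolding eq using step.IH by blast
  ultimately show ?case by blast
qed

text \<open>
  Each step only replaces a triangle by parts of itself.
\<close>

lemma greedy_refines:
  assumes G: "greedy_partitions p A R f D0 \<T>" and N: "card D0 \<le> N" and "N \<le> M"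
  shows "T \<in> \<T> M \<Longrightarrow> \<exists>S\<in>\<T> N. T \<subseteq> S"
  using \<open>N \<le> M\<close>
proof (induction M arbitrary: T rule: dec_induct)
  case base
  then show ?case by blast
next
  case (step M)
  obtain U where U: "U \<in> \<T> M" and eq: "\<T> (Suc M) = (\<T> M - {U}) \<union> bisect U (R f U)"
    using greedy_step[OF G order_trans[OF N step.hyps(1)]] by (auto simp: is_arg_max_def)
  have "2 simplex U"
    using partition_simplex[OF conjunct1[OF greedy_tree_partition[OF G]]] U N step.hyps(1)
    by (meson order_trans)
  then have "S \<subseteq> U" if "S \<in> bisect U (R f U)" for S
    using partition_subset[OF bisect_rule_partition(1)] that by blast
  with step.prems eq U obtain S where "S \<in> \<T> M" "T \<subseteq> S" by blast
  with step.IH[of S] show ?case by (meson order_trans)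
qed

text \<open>
  The triangles chosen for splitting, called \<open>t N\<close> below, are pairwise distinct: were \<open>t N\<close> present again at a
  later stage, it would be contained in an element of the partition \<open>\<T> (Suc N)\<close>, that is,
  in one of its own children or in a triangle whose interior is disjoint from its own. So all but
  finitely many of them lie outside the finite set of triangles with large error, and the maximality
  of \<open>t N\<close> carries the bound to the whole partition.
\<close>

lemma greedy_error_eventually_small:
  assumes G: "greedy_partitions p A R f D0 \<T>"
    and fin: "finite {T \<in> \<Union>j. level j. local_error p A f T > \<delta>}"
  shows "\<exists>M\<ge>card D0. \<forall>N\<ge>M. \<forall>T\<in>\<T> N. local_error p A f T \<le> \<delta>"
proof -
  obtain t where arg: "\<And>N. card D0 \<le> N \<Longrightarrow> is_arg_max (local_error p A f) (\<lambda>T. T \<in> \<T> N) (t N)"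
    and split: "\<And>N. card D0 \<le> N \<Longrightarrow> \<T> (Suc N) = (\<T> N - {t N}) \<union> bisect (t N) (R f (t N))"
    using greedy_step[OF G] by metis
  have t: "t N \<in> \<T> N" if "card D0 \<le> N" for N using arg[OF that] by (simp add: is_arg_max_def)
  have t_simp: "2 simplex (t N)" if "card D0 \<le> N" for N
    using partition_simplex[OF conjunct1[OF greedy_tree_partition[OF G that]] t[OF that]] .
  have ne: "t N \<noteq> t M" if N: "card D0 \<le> N" and M: "N < M" for N M
  proof
    assume "t N = t M"
    then have "t N \<in> \<T> M" using t[of M] N M by simp
    then obtain S where S: "S \<in> \<T> (Suc N)" "t N \<subseteq> S"
      using greedy_refines[OF G _ Suc_leI[OF M]] N by (metis le_SucI)
    then consider "S \<in> \<T> N" "S \<noteq> t N" | "S \<in> bisect (t N) (R f (t N))"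
      using split[OF N] by blast
    then show False
    proof cases
      case 1
      then have "interior S \<inter> interior (t N) = {}"
        using partition_disjoint[OF conjunct1[OF greedy_tree_partition[OF G N]]] t[OF N] by blast
      with interior_mono[OF S(2)] show False using interior_triangle_nonempty[OF t_simp[OF N]] by blast
    next
      case 2
      then have "S \<subseteq> t N" using partition_subset[OF bisect_rule_partition(1)[OF t_simp[OF N]]] by blast
      with S(2) 2 show False using bisect_rule_partition(2)[OF t_simp[OF N]] by auto
    qed
  qed
  have inj: "inj_on t {card D0..}"
    using ne by (intro inj_onI) (metis atLeast_iff linorder_neqE_nat)
  let ?big = "{T \<in> \<Union>j. level j. local_error p A f T > \<delta>}"
  have "finite (t -` ?big \<inter> {card D0..})" using finite_vimage_IntI[OF fin inj] .
  then obtain M where "t -` ?big \<inter> {card D0..} \<subseteq> {..M}"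
    unfolding finite_nat_iff_bounded_le by blast
  then have M: "N \<le> M" if "card D0 \<le> N" "t N \<in> ?big" for N
    using that by (auto simp: subset_iff)
  have "local_error p A f T \<le> \<delta>" if "max (card D0) (Suc M) \<le> N" "T \<in> \<T> N" for N T
  proof -
    have N: "card D0 \<le> N" "M < N" using that by auto
    then have "t N \<notin> ?big" using M[of N] by auto
    moreover have "t N \<in> (\<Union>j. level j)"
      using t[OF N(1)] greedy_tree_partition[OF G N(1)] by blast
    ultimately have "\<not> local_error p A f (t N) > \<delta>" by blast
    moreover have "local_error p A f T \<le> local_error p A f (t N)"
      using arg[OF N(1)] that(2) by (simp add: is_arg_max_def) (meson not_le)
    ultimately show ?thesis by linarith
  qed
  then show ?thesis by (intro exI[of _ "max (card D0) (Suc M)"]) auto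
qed

section \<open>Convergence of the tree approximations\<close>

context
  fixes p :: ereal and m :: nat and X :: "(real^2) set \<Rightarrow> plane_fun set"
    and A :: "triangle \<Rightarrow> plane_fun \<Rightarrow> plane_fun"
  assumes p: "1 \<le> p" and X: "function_class p X" and A: "local_approximation p m X A"
    and f: "f \<in> X \<Omega>"
begin

lemma target_Lp: "f \<in> Lp p \<Omega>"
  using function_class_Lp[OF X p partition_compact[OF D0] f] .

lemma target_on_piece:
  assumes P: "triangle_partition \<Omega> \<P>" and T: "T \<in> \<P>"
  shows "f \<in> X T"
  using function_class_subset[OF X f partition_subset[OF P T]]
    triangle_sets[OF partition_simplex[OF P T]] partition_sets[OF P] .

lemma piecewise_approx_V_level:
  assumes P: "triangle_partition \<Omega> \<P>"
  shows "piecewise_approx A f \<P> \<in> V_level m \<P>"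
  unfolding V_level_def
  using local_approximation_Poly[OF A partition_simplex[OF P] target_on_piece[OF P]]
    piecewise_approx_on_piece[OF P] by blast

text \<open>
  The approximation is polynomial on the elements of the partition, hence on all smaller triangles
  of a level that refines it.
\<close>

lemma piecewise_approx_V_space:
  assumes P: "triangle_partition \<Omega> \<P>" and sub: "\<P> \<subseteq> (\<Union>j. level j)"
  shows "piecewise_approx A f \<P> \<in> V_space m R f D0"
proof -
  obtain J where J: "\<And>T. T \<in> level J \<Longrightarrow> \<exists>S\<in>\<P>. T \<subseteq> S"
    using tree_partition_coarser_than_level[OF P sub] by blast
  have "piecewise_approx A f \<P> \<in> V_level m (level J)"
    unfolding V_level_def
  proof (intro CollectI ballI)
    fix T assume T: "T \<in> level J"
    obtain S where S: "S \<in> \<P>" "T \<subseteq> S" using J[OF T] by blast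
    obtain \<pi> where \<pi>: "\<pi> \<in> Poly m" "AE x in lebesgue_on S. piecewise_approx A f \<P> x = \<pi> x"
      using V_levelD[OF piecewise_approx_V_level[OF P] S(1)] by blast
    have "AE x in lebesgue_on T. piecewise_approx A f \<P> x = \<pi> x"
      using \<pi>(2) by (intro AE_lebesgue_on_subset[OF S(2)] triangle_sets)
        (auto intro: partition_simplex[OF P S(1)] partition_simplex[OF hierarchy_partition T])
    with \<pi>(1) show "\<exists>\<pi>\<in>Poly m. AE x in lebesgue_on T. piecewise_approx A f \<P> x = \<pi> x" by blast
  qed
  then show ?thesis by (auto simp: V_space_def)
qed

lemma error_Lp:
  assumes P: "triangle_partition \<Omega> \<P>" and g: "g \<in> V_level m \<P>"
  shows "(\<lambda>x. f x - g x) \<in> Lp p \<Omega>"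
  using Lp_diff[OF p target_Lp V_level_Lp[OF p P g]] .

lemma error_on_piece:
  assumes P: "triangle_partition \<Omega> \<P>" and T: "T \<in> \<P>"
  shows "Lp_norm p T (\<lambda>x. f x - piecewise_approx A f \<P> x) = local_error p A f T"
  unfolding local_error_def
proof (rule Lp_norm_cong_AE)
  show T': "T \<in> sets lebesgue" using triangle_sets[OF partition_simplex[OF P T]] .
  show "(\<lambda>x. f x - piecewise_approx A f \<P> x) \<in> borel_measurable (lebesgue_on T)"
    using Lp_measurable[OF Lp_subset[OF partition_subset[OF P T] T' partition_sets[OF P]
        error_Lp[OF P piecewise_approx_V_level[OF P]]]] .
  show "AE x in lebesgue_on T. f x - piecewise_approx A f \<P> x = f x - A T f x"
    using piecewise_approx_on_piece[OF P T] by (rule eventually_mono) simp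
qed

lemma tree_cost_powr:
  assumes P: "triangle_partition \<Omega> \<P>" and r: "p = ereal r" "1 \<le> r"
  shows "tree_cost p A f \<P> = Lp_norm p \<Omega> (\<lambda>x. f x - piecewise_approx A f \<P> x) powr r"
  using partition_Lp_norm_powr[OF P r(2), of "\<lambda>x. f x - piecewise_approx A f \<P> x"]
    error_Lp[OF P piecewise_approx_V_level[OF P]] error_on_piece[OF P] r
  by (simp add: tree_cost_def)

lemma tree_cost_infty:
  assumes P: "triangle_partition \<Omega> \<P>" and "\<P> \<noteq> {}" "p = \<infinity>"
  shows "tree_cost p A f \<P> = Lp_norm p \<Omega> (\<lambda>x. f x - piecewise_approx A f \<P> x)"
  using partition_Lp_norm_infty[OF P \<open>\<P> \<noteq> {}\<close>, of "\<lambda>x. f x - piecewise_approx A f \<P> x"]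
    error_Lp[OF P piecewise_approx_V_level[OF P]] error_on_piece[OF P] \<open>p = \<infinity>\<close>
  by (simp add: tree_cost_def)

text \<open>
  The tree cost is the error itself for \<open>p = \<infinity>\<close> and its \<open>p\<close>-th power otherwise; in both cases a
  small cost means a small error.
\<close>

lemma tree_cost_controls_error:
  assumes "0 < \<epsilon>"
  obtains \<eta> where "0 < \<eta>"
    "\<And>\<P>. triangle_partition \<Omega> \<P> \<Longrightarrow> \<P> \<noteq> {} \<Longrightarrow> tree_cost p A f \<P> \<le> \<eta> \<Longrightarrow>
      Lp_norm p \<Omega> (\<lambda>x. f x - piecewise_approx A f \<P> x) \<le> \<epsilon>"
proof (cases rule: ereal_exponent_cases[OF p])
  case 1
  then show thesis using that[OF assms] tree_cost_infty by simp
next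
  case (2 r)
  show thesis
  proof (rule that[of "\<epsilon> powr r"])
    show "0 < \<epsilon> powr r" using assms by simp
    fix \<P> assume P: "triangle_partition \<Omega> \<P>" "tree_cost p A f \<P> \<le> \<epsilon> powr r"
    then have "Lp_norm p \<Omega> (\<lambda>x. f x - piecewise_approx A f \<P> x) powr r \<le> \<epsilon> powr r"
      using tree_cost_powr 2 by simp
    then show "Lp_norm p \<Omega> (\<lambda>x. f x - piecewise_approx A f \<P> x) \<le> \<epsilon>"
      by (rule powr_le_imp_le[rotated -1]) (use 2 assms in simp_all)
  qed
qed

lemma closure_approximant:
  assumes "f \<in> Lp_closure p \<Omega> (V_space m R f D0)" "0 < \<epsilon>"
  obtains J g where "g \<in> V_level m (level J)" "Lp_norm p \<Omega> (\<lambda>x. f x - g x) < \<epsilon>"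
proof -
  have "\<forall>\<epsilon>>0. \<exists>g\<in>V_space m R f D0. Lp_norm p \<Omega> (\<lambda>x. f x - g x) < \<epsilon>"
    using assms(1) by (simp add: Lp_closure_def)
  from this[rule_format, OF assms(2)]
  obtain g where g: "g \<in> V_space m R f D0" "Lp_norm p \<Omega> (\<lambda>x. f x - g x) < \<epsilon>" ..
  then obtain J where "g \<in> V_level m (level J)" unfolding V_space_def by blast
  with g(2) show thesis using that by blast
qed

text \<open>
  A triangle of level at least \<open>J\<close> is contained in one of level \<open>J\<close>, so \<open>g\<close> competes as a polynomial
  in the near-best estimate.
\<close>

lemma deep_local_error:
  obtains C where "1 \<le> C"
    "\<And>g J j T. g \<in> V_level m (level J) \<Longrightarrow> J \<le> j \<Longrightarrow> T \<in> level j \<Longrightarrow>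
      local_error p A f T \<le> C * Lp_norm p T (\<lambda>x. f x - g x)"
proof -
  obtain C where C: "1 \<le> C" "\<And>T g \<pi>. 2 simplex T \<Longrightarrow> g \<in> X T \<Longrightarrow> \<pi> \<in> Poly m \<Longrightarrow>
      local_error p A g T \<le> C * Lp_norm p T (\<lambda>x. g x - \<pi> x)"
    using local_approximation_near_best[OF A] by blast
  note part = hierarchy_partition
  have "local_error p A f T \<le> C * Lp_norm p T (\<lambda>x. f x - g x)"
    if g: "g \<in> V_level m (level J)" and "J \<le> j" and T: "T \<in> level j" for g J j T
  proof -
    obtain S where S: "S \<in> level J" "T \<subseteq> S" using hierarchy_ancestor[OF \<open>J \<le> j\<close> T] by blast
    note T_simp = partition_simplex[OF part T]
    obtain \<pi> where \<pi>: "\<pi> \<in> Poly m" "AE x in lebesgue_on S. g x = \<pi> x"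
      using V_levelD[OF g S(1)] by blast
    have "AE x in lebesgue_on T. g x = \<pi> x"
      using AE_lebesgue_on_subset[OF S(2) triangle_sets[OF T_simp]
          triangle_sets[OF partition_simplex[OF part S(1)]] \<pi>(2)] .
    then have "AE x in lebesgue_on T. f x - g x = f x - \<pi> x" by (rule eventually_mono) simp
    then have "Lp_norm p T (\<lambda>x. f x - g x) = Lp_norm p T (\<lambda>x. f x - \<pi> x)"
      using Lp_measurable[OF Lp_subset[OF partition_subset[OF part T] triangle_sets[OF T_simp]
          partition_sets[OF D0] error_Lp[OF part g]]]
      by (intro Lp_norm_cong_AE triangle_sets T_simp)
    then show ?thesis using C(2)[OF T_simp target_on_piece[OF part T] \<pi>(1)] by simp
  qed
  with C(1) that show thesis by blast
qed

text \<open>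
  Choose \<open>g\<close>, piecewise polynomial on some level \<open>J\<close>, within \<open>\<delta> / C\<close> of \<open>f\<close>, where \<open>C\<close> is the
  near-best constant. The norm of \<open>f - g\<close> on the whole domain bounds its norm on each triangle.
\<close>

lemma deep_errors_small:
  assumes cl: "f \<in> Lp_closure p \<Omega> (V_space m R f D0)" and "0 < \<delta>"
  obtains J where "\<forall>j\<ge>J. \<forall>T\<in>level j. local_error p A f T \<le> \<delta>"
proof -
  obtain C where C: "1 \<le> C"
    "\<And>g J j T. g \<in> V_level m (level J) \<Longrightarrow> J \<le> j \<Longrightarrow> T \<in> level j \<Longrightarrow>
      local_error p A f T \<le> C * Lp_norm p T (\<lambda>x. f x - g x)"
    using deep_local_error by blast
  note part = hierarchy_partition
  have "0 < \<delta> / C" using C(1) \<open>0 < \<delta>\<close> by simp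
  then obtain J g where g: "g \<in> V_level m (level J)" "Lp_norm p \<Omega> (\<lambda>x. f x - g x) < \<delta> / C"
    using closure_approximant[OF cl] by blast
  have "local_error p A f T \<le> \<delta>" if j: "J \<le> j" and T: "T \<in> level j" for j T
  proof -
    note T_simp = partition_simplex[OF part T]
    have "local_error p A f T \<le> C * Lp_norm p T (\<lambda>x. f x - g x)" using C(2)[OF g(1) j T] .
    also have "\<dots> \<le> C * Lp_norm p \<Omega> (\<lambda>x. f x - g x)"
      using Lp_norm_mono_set[OF p partition_subset[OF part T] triangle_sets[OF T_simp]
          partition_sets[OF D0] triangle_not_negligible[OF T_simp] error_Lp[OF part g(1)]] C(1)
      by (intro mult_left_mono) auto
    also have "\<dots> \<le> C * (\<delta> / C)" using g(2) C(1) by (intro mult_left_mono) auto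
    finally show ?thesis using C(1) by simp
  qed
  with that show thesis by blast
qed

lemma finitely_many_large_errors:
  assumes cl: "f \<in> Lp_closure p \<Omega> (V_space m R f D0)" and "0 < \<delta>"
  shows "finite {T \<in> \<Union>j. level j. local_error p A f T > \<delta>}"
proof -
  obtain J where small: "\<forall>j\<ge>J. \<forall>T\<in>level j. local_error p A f T \<le> \<delta>"
    using deep_errors_small[OF assms] .
  have "{T \<in> \<Union>j. level j. local_error p A f T > \<delta>} \<subseteq> (\<Union>j<J. level j)"
  proof
    fix T assume "T \<in> {T \<in> \<Union>j. level j. local_error p A f T > \<delta>}"
    then obtain j where j: "T \<in> level j" "local_error p A f T > \<delta>" by auto
    then have "j < J" using small by (meson not_le)
    with j show "T \<in> (\<Union>j<J. level j)" by blast
  qed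
  then show ?thesis by (rule finite_subset) (auto intro: partition_finite[OF hierarchy_partition])
qed

text \<open>
  Let \<open>g\<close> be piecewise polynomial on level \<open>J\<close> and close to \<open>f\<close>. For \<open>p < \<infinity>\<close> and any partition,
  the triangles of level at least \<open>J\<close> contribute at most \<open>C\<^sup>p\<close> times the \<open>p\<close>-th power of the norm of
  \<open>f - g\<close> to the cost, and there are only finitely many others. For \<open>p = \<infinity>\<close> it suffices to bound
  each local error. The hypothesis on the partition is an alternative for each triangle, so that it
  covers both the full level \<open>J\<close> and partitions with uniformly small local errors.
\<close>

lemma tree_cost_small:
  assumes cl: "f \<in> Lp_closure p \<Omega> (V_space m R f D0)" and "0 < \<eta>"
  obtains \<delta> J where "0 < \<delta>"
    "\<forall>\<P>. triangle_partition \<Omega> \<P> \<longrightarrow> \<P> \<noteq> {} \<longrightarrow> \<P> \<subseteq> (\<Union>j. level j) \<longrightarrow>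
      (\<forall>T\<in>\<P>. T \<in> (\<Union>j\<in>{J..}. level j) \<or> local_error p A f T \<le> \<delta>) \<longrightarrow>
      tree_cost p A f \<P> \<le> \<eta>"
proof -
  obtain C where C: "1 \<le> C"
    "\<And>g J j T. g \<in> V_level m (level J) \<Longrightarrow> J \<le> j \<Longrightarrow> T \<in> level j \<Longrightarrow>
      local_error p A f T \<le> C * Lp_norm p T (\<lambda>x. f x - g x)"
    using deep_local_error by blast
  note part = hierarchy_partition
  show thesis
  proof (cases rule: ereal_exponent_cases[OF p])
    case 1
    obtain J where deep: "\<forall>j\<ge>J. \<forall>T\<in>level j. local_error p A f T \<le> \<eta>"
      using deep_errors_small[OF assms] .
    show thesis
    proof (rule that[OF \<open>0 < \<eta>\<close>, of J], intro allI impI)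
      fix \<P> assume P: "triangle_partition \<Omega> \<P>" "\<P> \<noteq> {}"
        and small: "\<forall>T\<in>\<P>. T \<in> (\<Union>j\<in>{J..}. level j) \<or> local_error p A f T \<le> \<eta>"
      have "local_error p A f T \<le> \<eta>" if "T \<in> \<P>" for T
        using bspec[OF small that] deep by auto
      then show "tree_cost p A f \<P> \<le> \<eta>"
        using 1 P(2) partition_finite[OF P(1)] by (simp add: tree_cost_def)
    qed
  next
    case (2 r)
    \<comment> \<open>Deep and shallow triangles are each granted half of the cost: \<open>(C * \<epsilon>) powr r = \<eta> / 2\<close>, and
    \<open>card ?L * \<delta> powr r \<le> \<eta> / 2\<close> for the finite set \<open>?L\<close> of shallow triangles.\<close>
    define \<epsilon> where "\<epsilon> = (\<eta> / 2) powr (1 / r) / C"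
    have "0 < \<epsilon>" using C(1) \<open>0 < \<eta>\<close> by (simp add: \<epsilon>_def)
    then obtain J g where g: "g \<in> V_level m (level J)" "Lp_norm p \<Omega> (\<lambda>x. f x - g x) < \<epsilon>"
      using closure_approximant[OF cl] by blast
    have C\<epsilon>: "(C * \<epsilon>) powr r = \<eta> / 2"
      using C(1) 2 \<open>0 < \<eta>\<close> by (simp add: \<epsilon>_def powr_powr)
    let ?L = "\<Union>j<J. level j" and ?H = "\<Union>j\<in>{J..}. level j"
    have finL: "finite ?L" using partition_finite[OF part] by blast
    define \<delta> where "\<delta> = (\<eta> / (2 * (card ?L + 1))) powr (1 / r)"
    have \<delta>0: "0 < \<delta>" using \<open>0 < \<eta>\<close> by (simp add: \<delta>_def)
    have \<delta>: "card ?L * \<delta> powr r \<le> \<eta> / 2"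
      using 2 \<open>0 < \<eta>\<close> by (simp add: \<delta>_def powr_powr field_simps)
    show thesis
    proof (rule that[OF \<delta>0, of J], intro allI impI)
      fix \<P> assume P: "triangle_partition \<Omega> \<P>" "\<P> \<subseteq> (\<Union>j. level j)"
        and small: "\<forall>T\<in>\<P>. T \<in> ?H \<or> local_error p A f T \<le> \<delta>"
      note finP = partition_finite[OF P(1)]
      let ?e = "\<lambda>T. local_error p A f T powr r" and ?n = "\<lambda>T. Lp_norm p T (\<lambda>x. f x - g x)"
      have "(\<Sum>T\<in>\<P> \<inter> ?H. ?e T) \<le> (\<Sum>T\<in>\<P> \<inter> ?H. C powr r * ?n T powr r)"
      proof (rule sum_mono)
        fix T assume "T \<in> \<P> \<inter> ?H"
        then obtain j where j: "J \<le> j" "T \<in> level j" by auto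
        have "?e T \<le> (C * ?n T) powr r"
          using C(2)[OF g(1) j] 2 local_error_nonneg by (intro powr_mono2) auto
        then show "?e T \<le> C powr r * ?n T powr r"
          using C(1) Lp_norm_nonneg by (simp add: powr_mult)
      qed
      also have "\<dots> \<le> (\<Sum>T\<in>\<P>. C powr r * ?n T powr r)"
        using finP by (intro sum_mono2) auto
      also have "\<dots> = C powr r * Lp_norm p \<Omega> (\<lambda>x. f x - g x) powr r"
        using partition_Lp_norm_powr[OF P(1) 2(2), of "\<lambda>x. f x - g x"] error_Lp[OF part g(1)] 2(1)
        by (simp add: sum_distrib_left)
      also have "\<dots> = (C * Lp_norm p \<Omega> (\<lambda>x. f x - g x)) powr r"
        using C(1) Lp_norm_nonneg by (simp add: powr_mult)
      also have "\<dots> \<le> (C * \<epsilon>) powr r"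
        using g(2) C(1) 2 Lp_norm_nonneg[of p \<Omega>] by (intro powr_mono2 mult_left_mono) auto
      finally have high: "(\<Sum>T\<in>\<P> \<inter> ?H. ?e T) \<le> \<eta> / 2" using C\<epsilon> by simp
      have sub: "\<P> - ?H \<subseteq> ?L"
      proof
        fix T assume T: "T \<in> \<P> - ?H"
        then obtain j where "T \<in> level j" using P(2) by blast
        with T show "T \<in> ?L" by (metis DiffE UN_I atLeast_iff lessThan_iff not_le)
      qed
      have "(\<Sum>T\<in>\<P> - ?H. ?e T) \<le> (\<Sum>T\<in>\<P> - ?H. \<delta> powr r)"
      proof (rule sum_mono)
        fix T assume "T \<in> \<P> - ?H"
        then have "local_error p A f T \<le> \<delta>" using small by blast
        then show "?e T \<le> \<delta> powr r" using 2 local_error_nonneg by (intro powr_mono2) auto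
      qed
      also have "\<dots> = card (\<P> - ?H) * \<delta> powr r" by simp
      also have "\<dots> \<le> card ?L * \<delta> powr r"
        using card_mono[OF finL sub] by (intro mult_right_mono) auto
      finally have low: "(\<Sum>T\<in>\<P> - ?H. ?e T) \<le> \<eta> / 2" using \<delta> by simp
      have "tree_cost p A f \<P> = (\<Sum>T\<in>\<P>. ?e T)" using 2 by (simp add: tree_cost_def)
      also have "\<dots> = (\<Sum>T\<in>\<P> \<inter> ?H. ?e T) + (\<Sum>T\<in>\<P> - ?H. ?e T)"
        by (rule sum.Int_Diff[OF finP])
      also have "\<dots> \<le> \<eta>" using high low by simp
      finally show "tree_cost p A f \<P> \<le> \<eta>" .
    qed
  qed
qed

text \<open>
  The approximations themselves are the required elements of the multiresolution space.
\<close>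

lemma convergence_imp_closure:
  assumes "\<And>N. N0 \<le> N \<Longrightarrow> triangle_partition \<Omega> (\<T> N) \<and> \<T> N \<subseteq> (\<Union>j. level j)"
    and "(\<lambda>N. Lp_norm p \<Omega> (\<lambda>x. f x - piecewise_approx A f (\<T> N) x)) \<longlonglongrightarrow> 0"
  shows "f \<in> Lp_closure p \<Omega> (V_space m R f D0)"
  unfolding Lp_closure_def
proof (intro CollectI conjI allI impI)
  show "f \<in> Lp p \<Omega>" by (rule target_Lp)
  fix \<epsilon> :: real assume "0 < \<epsilon>"
  with assms(2) have "\<forall>\<^sub>F N in sequentially. Lp_norm p \<Omega> (\<lambda>x. f x - piecewise_approx A f (\<T> N) x) < \<epsilon>"
    by (rule order_tendstoD(2))
  then have "\<forall>\<^sub>F N in sequentially. N0 \<le> N \<and> Lp_norm p \<Omega> (\<lambda>x. f x - piecewise_approx A f (\<T> N) x) < \<epsilon>"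
    using eventually_ge_at_top by (rule eventually_conj[rotated])
  then obtain N where N: "N0 \<le> N" "Lp_norm p \<Omega> (\<lambda>x. f x - piecewise_approx A f (\<T> N) x) < \<epsilon>"
    using eventually_happens'[OF sequentially_bot] by blast
  with assms(1)[OF N(1)] piecewise_approx_V_space
  show "\<exists>g\<in>V_space m R f D0. Lp_norm p \<Omega> (\<lambda>x. f x - g x) < \<epsilon>" by blast
qed

lemma error_tendsto_0I:
  assumes "D0 \<noteq> {}"
    and tree: "\<And>N. N0 \<le> N \<Longrightarrow> triangle_partition \<Omega> (\<T> N)"
    and cost: "\<And>\<eta>. 0 < \<eta> \<Longrightarrow> \<exists>M. \<forall>N\<ge>M. tree_cost p A f (\<T> N) \<le> \<eta>"
  shows "(\<lambda>N. Lp_norm p \<Omega> (\<lambda>x. f x - piecewise_approx A f (\<T> N) x)) \<longlonglongrightarrow> 0"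
proof (rule LIMSEQ_I)
  fix \<epsilon> :: real assume "0 < \<epsilon>"
  then have "0 < \<epsilon> / 2" by simp
  then obtain \<eta> where \<eta>: "0 < \<eta>" "\<And>\<P>. triangle_partition \<Omega> \<P> \<Longrightarrow> \<P> \<noteq> {} \<Longrightarrow>
      tree_cost p A f \<P> \<le> \<eta> \<Longrightarrow> Lp_norm p \<Omega> (\<lambda>x. f x - piecewise_approx A f \<P> x) \<le> \<epsilon> / 2"
    using tree_cost_controls_error by blast
  obtain M where M: "\<And>N. M \<le> N \<Longrightarrow> tree_cost p A f (\<T> N) \<le> \<eta>" using cost[OF \<eta>(1)] by blast
  have "\<Omega> \<noteq> {}"
    using \<open>D0 \<noteq> {}\<close> partition_Union[OF D0] partition_simplex[OF D0] interior_triangle_nonempty interior_subset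
    by (metis Union_empty_conv all_not_in_conv interior_empty)
  then have ne: "\<T> N \<noteq> {}" if "N0 \<le> N" for N using partition_Union[OF tree[OF that]] by auto
  show "\<exists>N1. \<forall>N\<ge>N1. norm (Lp_norm p \<Omega> (\<lambda>x. f x - piecewise_approx A f (\<T> N) x) - 0) < \<epsilon>"
  proof (intro exI[of _ "max N0 M"] allI impI)
    fix N assume "max N0 M \<le> N"
    then have N: "N0 \<le> N" "M \<le> N" by simp_all
    have "Lp_norm p \<Omega> (\<lambda>x. f x - piecewise_approx A f (\<T> N) x) \<le> \<epsilon> / 2"
      using \<eta>(2)[OF tree[OF N(1)] ne[OF N(1)] M[OF N(2)]] .
    then show "norm (Lp_norm p \<Omega> (\<lambda>x. f x - piecewise_approx A f (\<T> N) x) - 0) < \<epsilon>"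
      using \<open>0 < \<epsilon>\<close> Lp_norm_nonneg[of p \<Omega>] by simp
  qed
qed

theorem greedy_converges_iff:
  assumes G: "greedy_partitions p A R f D0 \<T>"
  shows "f \<in> Lp_closure p \<Omega> (V_space m R f D0) \<longleftrightarrow>
    (\<lambda>N. Lp_norm p \<Omega> (\<lambda>x. f x - piecewise_approx A f (\<T> N) x)) \<longlonglongrightarrow> 0"
proof
  note tree = greedy_tree_partition[OF G]
  show "f \<in> Lp_closure p \<Omega> (V_space m R f D0)"
    if "(\<lambda>N. Lp_norm p \<Omega> (\<lambda>x. f x - piecewise_approx A f (\<T> N) x)) \<longlonglongrightarrow> 0"
    using convergence_imp_closure[OF tree that] .
  assume cl: "f \<in> Lp_closure p \<Omega> (V_space m R f D0)"
  have neT: "\<T> N \<noteq> {}" if "card D0 \<le> N" for N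
    using greedy_step[OF G that] by (auto simp: is_arg_max_def)
  from greedy_initial_nonempty[OF G] show "(\<lambda>N. Lp_norm p \<Omega> (\<lambda>x. f x - piecewise_approx A f (\<T> N) x)) \<longlonglongrightarrow> 0"
  proof (rule error_tendsto_0I)
    show "triangle_partition \<Omega> (\<T> N)" if "card D0 \<le> N" for N using tree[OF that] by blast
    fix \<eta> :: real assume "0 < \<eta>"
    then obtain \<delta> J where "0 < \<delta>" and small: "\<forall>\<P>. triangle_partition \<Omega> \<P> \<longrightarrow> \<P> \<noteq> {} \<longrightarrow>
        \<P> \<subseteq> (\<Union>j. level j) \<longrightarrow>
        (\<forall>T\<in>\<P>. T \<in> (\<Union>j\<in>{J..}. level j) \<or> local_error p A f T \<le> \<delta>) \<longrightarrow>
        tree_cost p A f \<P> \<le> \<eta>"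
      by (rule tree_cost_small[OF cl _ that])
    obtain M where M: "card D0 \<le> M" "\<And>N T. M \<le> N \<Longrightarrow> T \<in> \<T> N \<Longrightarrow> local_error p A f T \<le> \<delta>"
      using greedy_error_eventually_small[OF G finitely_many_large_errors[OF cl \<open>0 < \<delta>\<close>]] by blast
    have "tree_cost p A f (\<T> N) \<le> \<eta>" if N: "M \<le> N" for N
      using tree[of N] neT[of N] M(1) N by (intro small[rule_format] disjI2 M(2)[OF N]) auto
    then show "\<exists>M. \<forall>N\<ge>M. tree_cost p A f (\<T> N) \<le> \<eta>" by blast
  qed
qed

text \<open>
  The full level \<open>J\<close> is a competitor for all \<open>N\<close> that are at least its cardinality.
\<close>

theorem optimal_converges_iff:
  assumes O: "optimal_partitions p \<Omega> A R f D0 \<T>" and "D0 \<noteq> {}"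
  shows "f \<in> Lp_closure p \<Omega> (V_space m R f D0) \<longleftrightarrow>
    (\<lambda>N. Lp_norm p \<Omega> (\<lambda>x. f x - piecewise_approx A f (\<T> N) x)) \<longlonglongrightarrow> 0"
proof
  note part = hierarchy_partition
  have tree: "triangle_partition \<Omega> (\<T> N) \<and> \<T> N \<subseteq> (\<Union>j. level j)" if "card D0 \<le> N" for N
    using O that by (auto simp: optimal_partitions_def is_arg_min_def tree_partition_def)
  have best: "tree_cost p A f (\<T> N) \<le> tree_cost p A f \<P>"
    if "card D0 \<le> N" "tree_partition \<Omega> R f D0 N \<P>" for N \<P>
    using O that unfolding optimal_partitions_def is_arg_min_def by (metis not_le)
  show "f \<in> Lp_closure p \<Omega> (V_space m R f D0)"
    if "(\<lambda>N. Lp_norm p \<Omega> (\<lambda>x. f x - piecewise_approx A f (\<T> N) x)) \<longlonglongrightarrow> 0"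
    using convergence_imp_closure[OF tree that] .
  assume cl: "f \<in> Lp_closure p \<Omega> (V_space m R f D0)"
  from \<open>D0 \<noteq> {}\<close> show "(\<lambda>N. Lp_norm p \<Omega> (\<lambda>x. f x - piecewise_approx A f (\<T> N) x)) \<longlonglongrightarrow> 0"
  proof (rule error_tendsto_0I)
    show "triangle_partition \<Omega> (\<T> N)" if "card D0 \<le> N" for N using tree[OF that] by blast
    fix \<eta> :: real assume "0 < \<eta>"
    then obtain \<delta> J where "0 < \<delta>" and small: "\<forall>\<P>. triangle_partition \<Omega> \<P> \<longrightarrow> \<P> \<noteq> {} \<longrightarrow>
        \<P> \<subseteq> (\<Union>j. level j) \<longrightarrow>
        (\<forall>T\<in>\<P>. T \<in> (\<Union>j\<in>{J..}. level j) \<or> local_error p A f T \<le> \<delta>) \<longrightarrow>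
        tree_cost p A f \<P> \<le> \<eta>"
      by (rule tree_cost_small[OF cl _ that])
    obtain T where "T \<in> D0" using \<open>D0 \<noteq> {}\<close> by blast
    then have "\<Omega> \<noteq> {}"
      using partition_subset[OF D0] interior_triangle_nonempty[OF partition_simplex[OF D0]] by fastforce
    then have "level J \<noteq> {}" using partition_Union[OF part[of J]] by auto
    then have level: "tree_cost p A f (level J) \<le> \<eta>"
      using part[of J] by (intro small[rule_format]) auto
    have "tree_cost p A f (\<T> N) \<le> \<eta>" if N: "max (card D0) (card (level J)) \<le> N" for N
    proof -
      have "tree_partition \<Omega> R f D0 N (level J)"
        using part[of J] N by (auto simp: tree_partition_def)
      then show ?thesis using best[of N "level J"] level N by simp
    qed
    then show "\<exists>M. \<forall>N\<ge>M. tree_cost p A f (\<T> N) \<le> \<eta>" by blast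
  qed
qed

end

section \<open>Wavelets and thresholding\<close>

context
  fixes m :: nat and \<phi> \<psi> :: "triangle \<Rightarrow> nat \<Rightarrow> plane_fun"
  assumes W: "wavelet_system m R f D0 \<phi> \<psi>"
begin

abbreviation (input) "children \<equiv> \<lambda>T. bisect T (R f T)"
abbreviation (input) "\<Lambda> \<equiv> wavelet_index m R f D0"
abbreviation (input) "w \<equiv> wavelet \<phi> \<psi>"

lemma V_level_refine:
  assumes "i \<le> j" and g: "g \<in> V_level m (level i)"
  shows "g \<in> V_level m (level j)"
  unfolding V_level_def
proof (intro CollectI ballI)
  fix T assume T: "T \<in> level j"
  obtain S where S: "S \<in> level i" "T \<subseteq> S" using hierarchy_ancestor[OF \<open>i \<le> j\<close> T] by blast
  obtain \<pi> where \<pi>: "\<pi> \<in> Poly m" "AE x in lebesgue_on S. g x = \<pi> x"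
    using V_levelD[OF g S(1)] by blast
  have "AE x in lebesgue_on T. g x = \<pi> x"
    using AE_lebesgue_on_subset[OF S(2) triangle_sets[OF partition_simplex[OF hierarchy_partition T]]
        triangle_sets[OF partition_simplex[OF hierarchy_partition S(1)]] \<pi>(2)] .
  with \<pi>(1) show "\<exists>\<pi>\<in>Poly m. AE x in lebesgue_on T. g x = \<pi> x" by blast
qed

lemma V_level_L2: "g \<in> V_level m (level j) \<Longrightarrow> g \<in> Lp 2 \<Omega>"
  using V_level_Lp[OF _ hierarchy_partition] by simp

lemma Poly_on_V_level:
  assumes T: "T \<in> level j" and g: "g \<in> Poly_on m T"
  shows "g \<in> V_level m (level j)"
  unfolding V_level_def
proof (intro CollectI ballI)
  fix S assume S: "S \<in> level j"
  obtain \<pi> where \<pi>: "\<pi> \<in> Poly m" "AE x in lebesgue. g x = indicat_real T x * \<pi> x"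
    using g by (auto simp: Poly_on_def)
  note Ss = triangle_sets[OF partition_simplex[OF hierarchy_partition S]]
  show "\<exists>\<pi>\<in>Poly m. AE x in lebesgue_on S. g x = \<pi> x"
  proof (cases "S = T")
    case True
    have "AE x in lebesgue_on S. g x = \<pi> x"
      unfolding AE_lebesgue_on_iff[OF Ss] using \<pi>(2) by (rule eventually_mono) (simp add: True)
    with \<pi>(1) show ?thesis by blast
  next
    case False
    have "AE x in lebesgue_on S. g x = 0"
      unfolding AE_lebesgue_on_iff[OF Ss] using \<pi>(2) AE_partition_interior[OF hierarchy_partition[of j]]
    proof eventually_elim
      case (elim x)
      show ?case
      proof
        assume "x \<in> S"
        then have "x \<notin> T" using elim(2) S T partition_disjoint[OF hierarchy_partition S T False] by blast
        then show "g x = 0" using elim(1) by simp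
      qed
    qed
    then show ?thesis by (rule bexI[where x = "\<lambda>x. 0"]) (rule Poly_zero)
  qed
qed

lemma child_level: "T \<in> level j \<Longrightarrow> S \<in> children T \<Longrightarrow> S \<in> level (Suc j)"
  by auto

lemma children_partition: "T \<in> level j \<Longrightarrow> triangle_partition T (children T)"
  using bisect_rule_partition(1) partition_simplex[OF hierarchy_partition] by blast

lemma Poly_sum_V_level:
  assumes T: "T \<in> level j" and g: "g \<in> Poly_sum m (children T)"
  shows "g \<in> V_level m (level (Suc j))"
proof -
  obtain h where h: "g = (\<lambda>x. \<Sum>S\<in>children T. h S x)" "\<And>S. S \<in> children T \<Longrightarrow> h S \<in> Poly_on m S"
    using g by (auto simp: Poly_sum_def)
  have "(\<lambda>x. \<Sum>S\<in>children T. 1 * h S x) \<in> V_level m (level (Suc j))"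
    using partition_finite[OF children_partition[OF T]] Poly_on_V_level[OF child_level[OF T] h(2)]
    by (rule V_level_sum)
  then show ?thesis using h(1) by simp
qed

lemma scaling_basis: "T \<in> D0 \<Longrightarrow> orthonormal_basis T (Poly_on m T) (num_basis m) (\<phi> T)"
  using W by (simp add: wavelet_system_def)

lemma detail_basis:
  assumes "T \<in> level j"
  shows "orthonormal_basis T {g \<in> Poly_sum m (children T). \<forall>h\<in>Poly_on m T. L2_inner T g h = 0}
    (num_basis m) (\<psi> T)"
  using W assms unfolding wavelet_system_def by blast

lemma orthonormal_basis_inner:
  "orthonormal_basis T U n b \<Longrightarrow> i \<in> {1..n} \<Longrightarrow> i' \<in> {1..n} \<Longrightarrow>
    L2_inner T (b i) (b i') = (if i = i' then 1 else 0)"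
  unfolding orthonormal_basis_def by blast

lemma scaling_Poly_on: "T \<in> D0 \<Longrightarrow> i \<in> {1..num_basis m} \<Longrightarrow> \<phi> T i \<in> Poly_on m T"
  using scaling_basis unfolding orthonormal_basis_def by blast

lemma detail_space:
  assumes "T \<in> level j" "i \<in> {1..num_basis m}"
  shows "\<psi> T i \<in> Poly_sum m (children T)" "h \<in> Poly_on m T \<Longrightarrow> L2_inner T (\<psi> T i) h = 0"
proof -
  have "\<psi> T i \<in> {g \<in> Poly_sum m (children T). \<forall>h\<in>Poly_on m T. L2_inner T g h = 0}"
    using detail_basis[OF assms(1)] assms(2) unfolding orthonormal_basis_def by blast
  then show "\<psi> T i \<in> Poly_sum m (children T)" "h \<in> Poly_on m T \<Longrightarrow> L2_inner T (\<psi> T i) h = 0"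
    by blast+
qed

lemma scaling_V_level: "T \<in> D0 \<Longrightarrow> i \<in> {1..num_basis m} \<Longrightarrow> \<phi> T i \<in> V_level m (level j)"
  using V_level_refine[of 0 j] Poly_on_V_level[of T 0] scaling_Poly_on by simp

lemma detail_V_level:
  assumes "T \<in> level j" "i \<in> {1..num_basis m}"
  shows "\<psi> T i \<in> V_level m (level (Suc j))"
  using Poly_sum_V_level[OF assms(1) detail_space(1)[OF assms]] .

lemma detail_outside:
  assumes T: "T \<in> level j" and i: "i \<in> {1..num_basis m}"
  shows "AE x in lebesgue. x \<notin> T \<longrightarrow> \<psi> T i x = 0"
  using detail_space(1)[OF T i] partition_finite[OF children_partition[OF T]]
    partition_subset[OF children_partition[OF T]] by (rule Poly_sum_outside)

lemma inner_on_triangle: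
  assumes T: "T \<in> level j" and g: "g \<in> Lp 2 \<Omega>" "h \<in> Lp 2 \<Omega>" and "AE x in lebesgue. x \<notin> T \<longrightarrow> g x = 0"
  shows "L2_inner \<Omega> g h = L2_inner T g h"
  using L2_inner_restrict[OF partition_subset[OF hierarchy_partition T] triangle_sets[OF partition_simplex[OF hierarchy_partition T]]
      partition_sets[OF D0] assms(2-4)] .

lemma inner_disjoint:
  assumes S: "S \<in> level j" and T: "T \<in> level j" and "S \<noteq> T"
    and g: "AE x in lebesgue. x \<notin> S \<longrightarrow> g x = 0" and h: "AE x in lebesgue. x \<notin> T \<longrightarrow> h x = 0"
  shows "L2_inner \<Omega> g h = 0"
  unfolding L2_inner_def
proof (rule integral_eq_zero_AE)
  show "AE x in lebesgue_on \<Omega>. g x * h x = 0"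
    unfolding AE_lebesgue_on_iff[OF partition_sets[OF D0]] using g h AE_partition_interior[OF hierarchy_partition[of j]]
  proof eventually_elim
    case (elim x)
    have "x \<notin> S \<or> x \<notin> T" using elim(3) S T partition_disjoint[OF hierarchy_partition S T \<open>S \<noteq> T\<close>] by blast
    then show ?case using elim(1,2) by auto
  qed
qed

text \<open>
  On the support \<open>T\<close> of the wavelet a coarse function is a polynomial, and the wavelet is orthogonal
  to polynomials on \<open>T\<close>. All orthogonality relations between different levels come from this.
\<close>

lemma detail_orthogonal_coarse:
  assumes T: "T \<in> level j" and i: "i \<in> {1..num_basis m}" and g: "g \<in> V_level m (level j)"
  shows "L2_inner \<Omega> (\<psi> T i) g = 0"
proof -
  note Ts = triangle_sets[OF partition_simplex[OF hierarchy_partition T]]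
  note sub = Lp_subset[OF partition_subset[OF hierarchy_partition T] Ts partition_sets[OF D0]]
  have L2: "\<psi> T i \<in> Lp 2 \<Omega>" "g \<in> Lp 2 \<Omega>" using V_level_L2 detail_V_level[OF T i] g by blast+
  obtain \<pi> where \<pi>: "\<pi> \<in> Poly m" "AE x in lebesgue_on T. g x = \<pi> x" using V_levelD[OF g T] by blast
  have "AE x in lebesgue_on T. g x = indicat_real T x * \<pi> x"
    using \<pi>(2) unfolding AE_lebesgue_on_iff[OF Ts] by (rule eventually_mono) simp
  then have "L2_inner T g (\<psi> T i) = L2_inner T (\<lambda>x. indicat_real T x * \<pi> x) (\<psi> T i)"
    by (rule L2_inner_cong_AE[OF Ts sub[OF L2(2)] sub[OF L2(1)]])
  also have "\<dots> = 0"
    using detail_space(2)[OF T i Poly_onI[OF \<pi>(1)]] by (simp add: L2_inner_commute)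
  finally show ?thesis
    using inner_on_triangle[OF T L2 detail_outside[OF T i]] by (simp add: L2_inner_commute)
qed

lemma scaling_orthonormal:
  assumes T: "T \<in> D0" "T' \<in> D0" and i: "i \<in> {1..num_basis m}" "i' \<in> {1..num_basis m}"
  shows "L2_inner \<Omega> (\<phi> T i) (\<phi> T' i') = (if T = T' \<and> i = i' then 1 else 0)"
proof -
  have T0: "T \<in> level 0" "T' \<in> level 0" using T by simp_all
  have out: "AE x in lebesgue. x \<notin> T \<longrightarrow> \<phi> T i x = 0" "AE x in lebesgue. x \<notin> T' \<longrightarrow> \<phi> T' i' x = 0"
    by (rule Poly_on_outside[OF scaling_Poly_on[OF T(1) i(1)]],
        rule Poly_on_outside[OF scaling_Poly_on[OF T(2) i(2)]])
  show ?thesis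
  proof (cases "T = T'")
    case True
    have "L2_inner \<Omega> (\<phi> T i) (\<phi> T' i') = L2_inner T (\<phi> T i) (\<phi> T' i')"
      by (rule inner_on_triangle[OF T0(1) V_level_L2[OF scaling_V_level[OF T(1) i(1), of 0]]
          V_level_L2[OF scaling_V_level[OF T(2) i(2), of 0]] out(1)])
    with True show ?thesis using orthonormal_basis_inner[OF scaling_basis[OF T(1)] i] by simp
  next
    case False
    then show ?thesis using inner_disjoint[OF T0 False out] by simp
  qed
qed

text \<open>
  Different triangles of one level have disjoint interiors; on different levels the coarser wavelet
  is a piecewise polynomial on the level of the finer one.
\<close>

lemma detail_orthonormal:
  assumes T: "T \<in> level j" and T': "T' \<in> level j'"
    and i: "i \<in> {1..num_basis m}" "i' \<in> {1..num_basis m}" and "j \<le> j'"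
  shows "L2_inner \<Omega> (\<psi> T' i') (\<psi> T i) = (if T = T' \<and> i = i' then 1 else 0)"
proof (cases "T = T'")
  case True
  have "L2_inner \<Omega> (\<psi> T' i') (\<psi> T i) = L2_inner T' (\<psi> T' i') (\<psi> T i)"
    using inner_on_triangle[OF T' V_level_L2[OF detail_V_level[OF T' i(2)]]
        V_level_L2[OF detail_V_level[OF T i(1)]] detail_outside[OF T' i(2)]] .
  with True show ?thesis using orthonormal_basis_inner[OF detail_basis[OF T'] i(2,1)] by auto
next
  case False
  show ?thesis
  proof (cases "j = j'")
    case True
    then have "T \<in> level j'" using T by simp
    then show ?thesis
      using inner_disjoint[OF T' _ False[symmetric] detail_outside[OF T' i(2)] detail_outside[OF T i(1)]]
        False by simp
  next
    case neq: False
    then have "Suc j \<le> j'" using \<open>j \<le> j'\<close> by simp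
    then show ?thesis
      using detail_orthogonal_coarse[OF T' i(2) V_level_refine[OF _ detail_V_level[OF T i(1)]]] False by simp
  qed
qed

lemma wavelet_index_cases:
  assumes "l \<in> \<Lambda>"
  obtains T i where "l = Inl (T, i)" "T \<in> D0" "i \<in> {1..num_basis m}"
  | T i j where "l = Inr (T, i)" "T \<in> level j" "i \<in> {1..num_basis m}"
  using assms unfolding wavelet_index_def by blast

lemma wavelet_V_level:
  assumes "l \<in> \<Lambda>"
  shows "\<exists>j. w l \<in> V_level m (level j)"
  using assms
proof (cases rule: wavelet_index_cases)
  case (1 T i)
  then have "w l \<in> V_level m (level 0)" using scaling_V_level[OF 1(2,3)]
    unfolding wavelet_def by (simp del: hierarchy.simps)
  then show ?thesis ..
next
  case (2 T i j)
  then have "w l \<in> V_level m (level (Suc j))"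
    unfolding wavelet_def using detail_V_level[OF 2(2,3)] by (simp del: hierarchy.simps)
  then show ?thesis ..
qed

lemma wavelet_L2: "l \<in> \<Lambda> \<Longrightarrow> w l \<in> Lp 2 \<Omega>"
  using wavelet_V_level V_level_L2 by blast

lemma wavelet_orthonormal:
  assumes k: "k \<in> \<Lambda>" and l: "l \<in> \<Lambda>"
  shows "L2_inner \<Omega> (w k) (w l) = (if k = l then 1 else 0)"
  using k
proof (cases rule: wavelet_index_cases)
  case k1: (1 T i)
  from l show ?thesis
  proof (cases rule: wavelet_index_cases)
    case (1 T' i')
    then show ?thesis using scaling_orthonormal[OF k1(2) 1(2) k1(3) 1(3)] k1 by (simp add: wavelet_def)
  next
    case (2 T' i' j)
    then show ?thesis
      using detail_orthogonal_coarse[OF 2(2,3) scaling_V_level[OF k1(2,3)]] k1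
      by (simp add: wavelet_def L2_inner_commute)
  qed
next
  case k2: (2 T i j)
  from l show ?thesis
  proof (cases rule: wavelet_index_cases)
    case (1 T' i')
    then show ?thesis
      using detail_orthogonal_coarse[OF k2(2,3) scaling_V_level[OF 1(2,3)]] k2
      by (simp add: wavelet_def L2_inner_commute)
  next
    case (2 T' i' j')
    show ?thesis
    proof (cases "j \<le> j'")
      case True
      then show ?thesis using detail_orthonormal[OF k2(2) 2(2) k2(3) 2(3)] k2 2
        by (simp add: wavelet_def L2_inner_commute[of \<Omega> "\<psi> T i"])
    next
      case False
      then show ?thesis using detail_orthonormal[OF 2(2) k2(2) 2(3) k2(3)] k2 2
        by (auto simp: wavelet_def)
    qed
  qed
qed

definition wavelet_span :: "plane_fun set" where
  "wavelet_span = {g. \<exists>F c. finite F \<and> F \<subseteq> \<Lambda> \<and> (AE x in lebesgue_on \<Omega>. g x = (\<Sum>l\<in>F. c l * w l x))}"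

lemma wavelet_spanI:
  "finite F \<Longrightarrow> F \<subseteq> \<Lambda> \<Longrightarrow> AE x in lebesgue_on \<Omega>. g x = (\<Sum>l\<in>F. c l * w l x) \<Longrightarrow> g \<in> wavelet_span"
  unfolding wavelet_span_def by blast

lemma wavelet_spanE:
  assumes "g \<in> wavelet_span"
  obtains F c where "finite F" "F \<subseteq> \<Lambda>" "AE x in lebesgue_on \<Omega>. g x = (\<Sum>l\<in>F. c l * w l x)"
  using assms unfolding wavelet_span_def by blast

lemma wavelet_span_AE:
  assumes "g \<in> wavelet_span" "AE x in lebesgue_on \<Omega>. h x = g x"
  shows "h \<in> wavelet_span"
proof -
  obtain F c where F: "finite F" "F \<subseteq> \<Lambda>" and g: "AE x in lebesgue_on \<Omega>. g x = (\<Sum>l\<in>F. c l * w l x)"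
    using wavelet_spanE[OF assms(1)] .
  from assms(2) g have "AE x in lebesgue_on \<Omega>. h x = (\<Sum>l\<in>F. c l * w l x)" by eventually_elim simp
  with F show ?thesis by (rule wavelet_spanI)
qed

lemma wavelet_span_add:
  assumes "g \<in> wavelet_span" "h \<in> wavelet_span"
  shows "(\<lambda>x. g x + h x) \<in> wavelet_span"
proof -
  obtain F c where F: "finite F" "F \<subseteq> \<Lambda>" and g: "AE x in lebesgue_on \<Omega>. g x = (\<Sum>l\<in>F. c l * w l x)"
    using wavelet_spanE[OF assms(1)] .
  obtain G d where G: "finite G" "G \<subseteq> \<Lambda>" and h: "AE x in lebesgue_on \<Omega>. h x = (\<Sum>l\<in>G. d l * w l x)"
    using wavelet_spanE[OF assms(2)] .
  have ext: "(\<Sum>l\<in>F. c l * w l x) = (\<Sum>l\<in>F \<union> G. (if l \<in> F then c l else 0) * w l x)"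
    "(\<Sum>l\<in>G. d l * w l x) = (\<Sum>l\<in>F \<union> G. (if l \<in> G then d l else 0) * w l x)" for x
    using F(1) G(1) by (auto intro!: sum.mono_neutral_cong_left)
  show ?thesis
  proof (rule wavelet_spanI)
    show "AE x in lebesgue_on \<Omega>. g x + h x =
      (\<Sum>l\<in>F \<union> G. ((if l \<in> F then c l else 0) + (if l \<in> G then d l else 0)) * w l x)"
      using g h by eventually_elim (simp only: ext distrib_right sum.distrib)
  qed (use F G in auto)
qed

lemma wavelet_span_sum:
  assumes "finite I" "\<And>i. i \<in> I \<Longrightarrow> g i \<in> wavelet_span"
  shows "(\<lambda>x. \<Sum>i\<in>I. g i x) \<in> wavelet_span"
  using assms
proof (induction I rule: finite_induct)
  case empty
  show ?case by (rule wavelet_spanI[of "{}"]) auto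
next
  case (insert i I)
  then show ?case using wavelet_span_add[of "g i" "\<lambda>x. \<Sum>i\<in>I. g i x"] by simp
qed

text \<open>
  The map \<open>\<iota>\<close> places a local basis in the family of all wavelets.
\<close>

lemma basis_expansion_span:
  assumes "orthonormal_basis T U (num_basis m) b" "g \<in> U"
    and \<iota>: "inj \<iota>" "\<And>i. i \<in> {1..num_basis m} \<Longrightarrow> \<iota> i \<in> \<Lambda>" "\<And>i. w (\<iota> i) = b i"
  shows "g \<in> wavelet_span"
proof -
  obtain c where c: "AE x in lebesgue. g x = (\<Sum>i=1..num_basis m. c i * b i x)"
    using assms(1,2) unfolding orthonormal_basis_def by blast
  have eq: "(\<Sum>l\<in>\<iota> ` {1..num_basis m}. c (inv \<iota> l) * w l x) = (\<Sum>i=1..num_basis m. c i * b i x)" for x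
    using \<iota>(1,3) by (subst sum.reindex) (auto intro: inj_on_subset)
  show ?thesis
  proof (rule wavelet_spanI)
    show "AE x in lebesgue_on \<Omega>. g x = (\<Sum>l\<in>\<iota> ` {1..num_basis m}. c (inv \<iota> l) * w l x)"
      unfolding AE_lebesgue_on_iff[OF partition_sets[OF D0]] using c
      by (rule eventually_mono) (simp only: eq simp_thms)
  qed (use \<iota>(2) in auto)
qed

lemma V_level_0_span:
  assumes g: "g \<in> V_level m D0"
  shows "g \<in> wavelet_span"
proof -
  obtain \<pi> where \<pi>: "\<And>T. T \<in> D0 \<Longrightarrow> \<pi> T \<in> Poly m" "\<And>T. T \<in> D0 \<Longrightarrow> AE x in lebesgue_on T. g x = \<pi> T x"
    using V_levelD[OF g] by metis
  have "(\<lambda>x. indicat_real T x * \<pi> T x) \<in> wavelet_span" if T: "T \<in> D0" for T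
    by (rule basis_expansion_span[OF scaling_basis[OF T] Poly_onI[OF \<pi>(1)[OF T]], of "\<lambda>i. Inl (T, i)"])
      (use T in \<open>auto simp: wavelet_def wavelet_index_def inj_def\<close>)
  then have "(\<lambda>x. \<Sum>T\<in>D0. indicat_real T x * \<pi> T x) \<in> wavelet_span"
    by (rule wavelet_span_sum[OF partition_finite[OF D0]])
  moreover have "AE x in lebesgue_on \<Omega>. g x = (\<Sum>T\<in>D0. indicat_real T x * \<pi> T x)"
    unfolding partition_AE_iff[OF D0]
  proof
    fix T assume T: "T \<in> D0"
    have "AE x in lebesgue. x \<in> T \<longrightarrow> g x = \<pi> T x"
      using \<pi>(2)[OF T] AE_lebesgue_on_iff[OF triangle_sets[OF partition_simplex[OF D0 T]]] by simp
    then show "AE x in lebesgue_on T. g x = (\<Sum>T\<in>D0. indicat_real T x * \<pi> T x)"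
      unfolding AE_lebesgue_on_iff[OF triangle_sets[OF partition_simplex[OF D0 T]]]
      using AE_partition_interior[OF D0]
    proof eventually_elim
      case (elim x)
      then show ?case using partition_sum_at_point[OF D0 T, of x "\<lambda>T. \<pi> T x"] by simp
    qed
  qed
  ultimately show ?thesis by (rule wavelet_span_AE)
qed

text \<open>
  Here \<open>q\<close> is the orthogonal projection of \<open>g\<close> onto the polynomials on \<open>T\<close>, and \<open>u\<close> is the rest
  \<open>g - q\<close>, extended by \<open>0\<close>. This rest is orthogonal to the polynomials on \<open>T\<close> and polynomial on the
  children of \<open>T\<close>, so the wavelets attached to \<open>T\<close> span it.
\<close>

lemma local_split:
  assumes T: "T \<in> level j" and g: "g \<in> V_level m (level (Suc j))"
  obtains q u where "q \<in> Poly m" "u \<in> wavelet_span" "\<And>x. x \<notin> T \<Longrightarrow> u x = 0"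
    "AE x in lebesgue_on T. g x = u x + q x"
proof -
  note Ts = triangle_sets[OF partition_simplex[OF hierarchy_partition T]]
  note CT = children_partition[OF T]
  have gT: "g \<in> Lp 2 T"
    using Lp_subset[OF partition_subset[OF hierarchy_partition T] Ts partition_sets[OF D0] V_level_L2[OF g]] .
  obtain q where q: "q \<in> Poly m" "\<forall>\<rho>\<in>Poly m. L2_inner T (\<lambda>x. g x - q x) \<rho> = 0"
    using Poly_projection[where m = m, OF partition_simplex[OF hierarchy_partition T] gT] .
  have qT: "q \<in> Lp 2 T"
    using continuous_Lp[OF _ compact_simplex[OF partition_simplex[OF hierarchy_partition T]] Poly_continuous[OF q(1)]] by simp
  obtain \<pi> where \<pi>: "\<And>S. S \<in> children T \<Longrightarrow> \<pi> S \<in> Poly m"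
    "\<And>S. S \<in> children T \<Longrightarrow> AE x in lebesgue_on S. g x = \<pi> S x"
    using V_levelD[OF g child_level[OF T]] by metis
  define u where "u = (\<lambda>x. \<Sum>S\<in>children T. indicat_real S x * (\<pi> S x - q x))"
  have outside: "u x = 0" if "x \<notin> T" for x
    unfolding u_def using that partition_subset[OF CT] by (intro sum.neutral) (auto simp: indicator_def)
  have eq: "AE x in lebesgue_on T. g x - q x = u x"
    unfolding partition_AE_iff[OF CT]
  proof
    fix S assume S: "S \<in> children T"
    note Ss = triangle_sets[OF partition_simplex[OF CT S]]
    have "AE x in lebesgue. x \<in> S \<longrightarrow> g x = \<pi> S x" using \<pi>(2)[OF S] AE_lebesgue_on_iff[OF Ss] by simp
    then show "AE x in lebesgue_on S. g x - q x = u x"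
      unfolding AE_lebesgue_on_iff[OF Ss] using AE_partition_interior[OF CT]
    proof eventually_elim
      case (elim x)
      then show ?case
        unfolding u_def using partition_sum_at_point[OF CT S, of x "\<lambda>S. \<pi> S x - q x"] by simp
    qed
  qed
  have "u \<in> {g \<in> Poly_sum m (children T). \<forall>h\<in>Poly_on m T. L2_inner T g h = 0}"
  proof (intro CollectI conjI ballI)
    have "(\<lambda>x. \<pi> S x - q x) \<in> Poly m" if "S \<in> children T" for S
      using Poly_linear[OF \<pi>(1)[OF that] q(1), of 1 "-1"] by simp
    then show "u \<in> Poly_sum m (children T)"
      unfolding u_def Poly_sum_def
      by (intro CollectI exI[of _ "\<lambda>S x. indicat_real S x * (\<pi> S x - q x)"]) (auto intro: Poly_onI)
    fix h assume "h \<in> Poly_on m T"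
    then obtain \<rho> where \<rho>: "\<rho> \<in> Poly m" "AE x in lebesgue. h x = indicat_real T x * \<rho> x"
      by (auto simp: Poly_on_def)
    have h: "AE x in lebesgue_on T. \<rho> x = h x"
      unfolding AE_lebesgue_on_iff[OF Ts] using \<rho>(2) by (rule eventually_mono) simp
    have \<rho>T: "\<rho> \<in> Lp 2 T"
      using continuous_Lp[OF _ compact_simplex[OF partition_simplex[OF hierarchy_partition T]] Poly_continuous[OF \<rho>(1)]] by simp
    have hT: "h \<in> Lp 2 T" using Lp_cong_AE[OF Ts Lp_measurable[OF \<rho>T] h] \<rho>T by simp
    have gq: "(\<lambda>x. g x - q x) \<in> Lp 2 T" using gT qT by (rule L2_diff)
    have "L2_inner T u h = L2_inner T (\<lambda>x. g x - q x) h"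
      using L2_inner_cong_AE[OF Ts gq hT eq] by simp
    also have "\<dots> = L2_inner T (\<lambda>x. g x - q x) \<rho>"
      using L2_inner_cong_AE[OF Ts \<rho>T gq h] by (simp add: L2_inner_commute)
    also have "\<dots> = 0" using q(2) \<rho>(1) by blast
    finally show "L2_inner T u h = 0" .
  qed
  then have "u \<in> wavelet_span"
    by (rule basis_expansion_span[OF detail_basis[OF T], of _ "\<lambda>i. Inr (T, i)"])
      (use T in \<open>auto simp: wavelet_def wavelet_index_def inj_def\<close>)
  moreover have "AE x in lebesgue_on T. g x = u x + q x" using eq by (rule eventually_mono) simp
  ultimately show thesis using that q(1) outside by blast
qed

text \<open>
  The projections onto the triangles of level \<open>j\<close> form a piecewise polynomial of level \<open>j\<close>, to which
  the induction hypothesis applies.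
\<close>

lemma V_level_span: "g \<in> V_level m (level j) \<Longrightarrow> g \<in> wavelet_span"
proof (induction j arbitrary: g)
  case 0
  then show ?case using V_level_0_span by simp
next
  case (Suc j)
  define splits where "splits T q u \<longleftrightarrow> q \<in> Poly m \<and> u \<in> wavelet_span \<and> (\<forall>x. x \<notin> T \<longrightarrow> u x = 0) \<and>
      (AE x in lebesgue_on T. g x = u x + q x)" for T q u
  have "\<exists>q u. splits T q u" if T: "T \<in> level j" for T
    unfolding splits_def by (rule local_split[OF T Suc.prems]) blast
  then obtain q u where "\<And>T. T \<in> level j \<Longrightarrow> splits T (q T) (u T)" by metis
  then have q: "\<And>T. T \<in> level j \<Longrightarrow> q T \<in> Poly m"
    and u: "\<And>T. T \<in> level j \<Longrightarrow> u T \<in> wavelet_span"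
      "\<And>T x. T \<in> level j \<Longrightarrow> x \<notin> T \<Longrightarrow> u T x = 0"
    and split: "\<And>T. T \<in> level j \<Longrightarrow> AE x in lebesgue_on T. g x = u T x + q T x"
    by (simp_all add: splits_def)
  let ?c = "\<lambda>x. \<Sum>T\<in>level j. 1 * (indicat_real T x * q T x)" and ?d = "\<lambda>x. \<Sum>T\<in>level j. u T x"
  have "?c \<in> V_level m (level j)"
    using partition_finite[OF hierarchy_partition] Poly_on_V_level[OF _ Poly_onI[OF q]] by (rule V_level_sum)
  then have "?c \<in> wavelet_span" by (rule Suc.IH)
  moreover have "?d \<in> wavelet_span" using partition_finite[OF hierarchy_partition] u(1) by (rule wavelet_span_sum)
  ultimately have "(\<lambda>x. ?d x + ?c x) \<in> wavelet_span" by (intro wavelet_span_add)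
  moreover have "AE x in lebesgue_on \<Omega>. g x = ?d x + ?c x"
    unfolding partition_AE_iff[OF hierarchy_partition[of j]]
  proof
    fix T assume T: "T \<in> level j"
    note Ts = triangle_sets[OF partition_simplex[OF hierarchy_partition T]]
    have "AE x in lebesgue. x \<in> T \<longrightarrow> g x = u T x + q T x" using split[OF T] AE_lebesgue_on_iff[OF Ts] by simp
    then show "AE x in lebesgue_on T. g x = ?d x + ?c x"
      unfolding AE_lebesgue_on_iff[OF Ts] using AE_partition_interior[OF hierarchy_partition[of j]]
    proof eventually_elim
      case (elim x)
      show ?case
      proof
        assume x: "x \<in> T"
        have "?d x = (\<Sum>S\<in>level j. indicat_real S x * u S x)"
          using u(2) by (intro sum.cong) (auto split: split_indicator)
        also have "\<dots> = u T x" using partition_sum_at_point[OF hierarchy_partition T x elim(2)] .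
        finally show "g x = ?d x + ?c x"
          using elim(1) x partition_sum_at_point[OF hierarchy_partition T x elim(2), of "\<lambda>T. q T x"] by simp
      qed
    qed
  qed
  ultimately show ?case by (rule wavelet_span_AE)
qed

theorem threshold_converges_iff:
  assumes f: "f \<in> Lp 2 \<Omega>"
  shows "f \<in> Lp_closure 2 \<Omega> (V_space m R f D0) \<longleftrightarrow>
    ((\<lambda>\<epsilon>. Lp_norm 2 \<Omega> (\<lambda>x. f x - threshold_approx m \<Omega> R f D0 \<phi> \<psi> \<epsilon> x)) \<longlongrightarrow> 0) (at_right 0)"
proof
  assume cl: "f \<in> Lp_closure 2 \<Omega> (V_space m R f D0)"
  show "((\<lambda>\<epsilon>. Lp_norm 2 \<Omega> (\<lambda>x. f x - threshold_approx m \<Omega> R f D0 \<phi> \<psi> \<epsilon> x)) \<longlongrightarrow> 0) (at_right 0)"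
    unfolding threshold_approx_def
  proof (rule threshold_tendsto[OF wavelet_L2 f wavelet_orthonormal])
    fix \<delta> :: real assume "0 < \<delta>"
    have "\<forall>\<epsilon>>0. \<exists>g\<in>V_space m R f D0. Lp_norm 2 \<Omega> (\<lambda>x. f x - g x) < \<epsilon>"
      using cl by (simp add: Lp_closure_def)
    then obtain g where g: "g \<in> V_space m R f D0" "Lp_norm 2 \<Omega> (\<lambda>x. f x - g x) < \<delta>"
      using \<open>0 < \<delta>\<close> by blast
    then obtain j where j: "g \<in> V_level m (level j)" unfolding V_space_def by blast
    obtain F c where F: "finite F" "F \<subseteq> \<Lambda>" "AE x in lebesgue_on \<Omega>. g x = (\<Sum>l\<in>F. c l * w l x)"
      using wavelet_spanE[OF V_level_span[OF j]] .
    have "Lp_norm 2 \<Omega> (\<lambda>x. f x - g x) = Lp_norm 2 \<Omega> (\<lambda>x. f x - (\<Sum>l\<in>F. c l * w l x))"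
    proof (rule Lp_norm_cong_AE[OF partition_sets[OF D0] Lp_measurable[OF L2_diff[OF f V_level_L2[OF j]]]])
      show "AE x in lebesgue_on \<Omega>. f x - g x = f x - (\<Sum>l\<in>F. c l * w l x)"
        using F(3) by (rule eventually_mono) simp
    qed
    with F(1,2) g(2)
    show "\<exists>F c. finite F \<and> F \<subseteq> \<Lambda> \<and> Lp_norm 2 \<Omega> (\<lambda>x. f x - (\<Sum>l\<in>F. c l * w l x)) < \<delta>" by auto
  qed
next
  assume lim: "((\<lambda>\<epsilon>. Lp_norm 2 \<Omega> (\<lambda>x. f x - threshold_approx m \<Omega> R f D0 \<phi> \<psi> \<epsilon> x)) \<longlongrightarrow> 0) (at_right 0)"
  show "f \<in> Lp_closure 2 \<Omega> (V_space m R f D0)"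
    unfolding Lp_closure_def
  proof (intro CollectI conjI allI impI)
    show "f \<in> Lp 2 \<Omega>" by (rule f)
    fix \<delta> :: real assume "0 < \<delta>"
    have "\<forall>\<^sub>F \<epsilon> in at_right 0. 0 < \<epsilon> \<and>
        Lp_norm 2 \<Omega> (\<lambda>x. f x - threshold_approx m \<Omega> R f D0 \<phi> \<psi> \<epsilon> x) < \<delta>"
      using eventually_at_right_less order_tendstoD(2)[OF lim \<open>0 < \<delta>\<close>] by (rule eventually_conj)
    then obtain \<epsilon> where \<epsilon>: "0 < \<epsilon>" "Lp_norm 2 \<Omega> (\<lambda>x. f x - threshold_approx m \<Omega> R f D0 \<phi> \<psi> \<epsilon> x) < \<delta>"
      using eventually_happens'[OF trivial_limit_at_right_real] by blast
    let ?B = "{l \<in> \<Lambda>. \<bar>L2_inner \<Omega> f (w l)\<bar> \<ge> \<epsilon>}"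
    have fin: "finite ?B"
      using finitely_many_large_coefficients[OF wavelet_L2 f wavelet_orthonormal \<epsilon>(1)] .
    obtain lev where lev: "\<And>l. l \<in> \<Lambda> \<Longrightarrow> w l \<in> V_level m (level (lev l))"
      using wavelet_V_level by metis
    define J where "J = Max (insert 0 (lev ` ?B))"
    have J: "w l \<in> V_level m (level J)" if "l \<in> ?B" for l
    proof (rule V_level_refine)
      show "lev l \<le> J" unfolding J_def using fin that by (intro Max_ge) auto
      show "w l \<in> V_level m (level (lev l))" using lev that by blast
    qed
    have "threshold_approx m \<Omega> R f D0 \<phi> \<psi> \<epsilon> \<in> V_level m (level J)"
      unfolding threshold_approx_def using fin J by (rule V_level_sum)
    then have "threshold_approx m \<Omega> R f D0 \<phi> \<psi> \<epsilon> \<in> V_space m R f D0" unfolding V_space_def by blast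
    with \<epsilon>(2) show "\<exists>g\<in>V_space m R f D0. Lp_norm 2 \<Omega> (\<lambda>x. f x - g x) < \<delta>" by blast
  qed
qed

end

end

theorem theorem3p1:
  fixes p :: ereal and m :: nat and \<Omega> :: "(real^2) set" and D0 :: "triangle set"
    and X :: "(real^2) set \<Rightarrow> plane_fun set" and A :: "triangle \<Rightarrow> plane_fun \<Rightarrow> plane_fun"
    and R :: "plane_fun \<Rightarrow> triangle \<Rightarrow> (real^2) set" and f :: plane_fun
    and \<T> \<T>opt :: "nat \<Rightarrow> triangle set"
    and \<phi> \<psi> :: "triangle \<Rightarrow> nat \<Rightarrow> plane_fun"
  assumes "1 \<le> p"
    and "triangle_partition \<Omega> D0"
    and "function_class p X"
    and "local_approximation p m X A"
    and "refinement_rule R"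
    and "f \<in> X \<Omega>"
    and "greedy_partitions p A R f D0 \<T>"
    and "optimal_partitions p \<Omega> A R f D0 \<T>opt"
    and "p = 2 \<Longrightarrow> wavelet_system m R f D0 \<phi> \<psi>"
  shows "(f \<in> Lp_closure p \<Omega> (V_space m R f D0) \<longleftrightarrow>
            (\<lambda>N. Lp_norm p \<Omega> (\<lambda>x. f x - piecewise_approx A f (\<T> N) x)) \<longlonglongrightarrow> 0)
       \<and> (f \<in> Lp_closure p \<Omega> (V_space m R f D0) \<longleftrightarrow>
            (\<lambda>N. Lp_norm p \<Omega> (\<lambda>x. f x - piecewise_approx A f (\<T>opt N) x)) \<longlonglongrightarrow> 0)
       \<and> (p = 2 \<longrightarrow>
           (f \<in> Lp_closure p \<Omega> (V_space m R f D0) \<longleftrightarrow>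
            ((\<lambda>\<epsilon>. Lp_norm 2 \<Omega> (\<lambda>x. f x - threshold_approx m \<Omega> R f D0 \<phi> \<psi> \<epsilon> x)) \<longlongrightarrow> 0)
              (at_right 0)))"
proof (intro conjI impI)
  note base = \<open>refinement_rule R\<close> \<open>triangle_partition \<Omega> D0\<close> \<open>1 \<le> p\<close> \<open>function_class p X\<close>
    \<open>local_approximation p m X A\<close> \<open>f \<in> X \<Omega>\<close>
  show "f \<in> Lp_closure p \<Omega> (V_space m R f D0) \<longleftrightarrow>
      (\<lambda>N. Lp_norm p \<Omega> (\<lambda>x. f x - piecewise_approx A f (\<T> N) x)) \<longlonglongrightarrow> 0"
    by (rule greedy_converges_iff[OF base assms(7)])
  have "D0 \<noteq> {}" by (rule greedy_initial_nonempty[OF assms(7)])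
  then show "f \<in> Lp_closure p \<Omega> (V_space m R f D0) \<longleftrightarrow>
      (\<lambda>N. Lp_norm p \<Omega> (\<lambda>x. f x - piecewise_approx A f (\<T>opt N) x)) \<longlonglongrightarrow> 0"
    by (rule optimal_converges_iff[OF base assms(8)])
  assume p2: "p = 2"
  have "f \<in> Lp 2 \<Omega>" using target_Lp[OF base] p2 by simp
  from threshold_converges_iff[OF assms(5,2) assms(9)[OF p2] this]
  show "f \<in> Lp_closure p \<Omega> (V_space m R f D0) \<longleftrightarrow>
      ((\<lambda>\<epsilon>. Lp_norm 2 \<Omega> (\<lambda>x. f x - threshold_approx m \<Omega> R f D0 \<phi> \<psi> \<epsilon> x)) \<longlongrightarrow> 0) (at_right 0)"
    unfolding p2 .
qed

end
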